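(* Let $r \geq 3$. If $\mathcal{F}$ is a $\{C_2, C_3, K_{2,3}\}$-free $r$-uniform $r$-partite hypergraph with $n$ vertices in each part, then \[ |E(\mathcal{F})| \leq \sqrt{\frac{2}{r-1}}\, n^{3/2} + n. \] Furthermore, for any $q$ that is a power of an odd prime, there is a $3$-uniform $3$-partite $\{C_2, C_3, K_{2,3}\}$-free hypergraph with $q^2$ vertices in each part and $q^2(q-1)$ edges.
   Context: Let $G$ be a multigraph and $\mathcal{F}$ a hypergraph. $\mathcal{F}$ is a Berge-$G$ if there is a bijection $f: E(G) \to E(\mathcal{F})$ with $e \subseteq f(e)$ for every $e \in E(G)$. For a family $\mathcal{G}$ of multigraphs, a hypergraph $\mathcal{H}$ is $\mathcal{G}$-free if for every $G \in \mathcal{G}$, $\mathcal{H}$ contains no subhypergraph isomorphic to a Berge-$G$. $C_2$ is the multigraph consisting of two vertices joined by two parallel edges (so $C_2$-free means linear: two distinct edges share at most one vertex), $C_3$ is the triangle, $K_{2,3}$ the complete bipartite graph with parts of sizes $2$ and $3$. An $r$-uniform hypergraph is $r$-partite if its vertex set is partitioned into $r$ parts such that each edge contains exactly one vertex from each part. *)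

theory Defs
  imports Complex_Main "HOL-Computational_Algebra.Primes"
begin

text \<open>A finite multigraph is given by a vertex set V, a set of edge labels E, and an
  endpoint map ends assigning to each edge label a set of one or two vertices
  (parallel edges are distinct labels with the same endpoints).  Vertices and
  edge labels are natural numbers.\<close>

definition contains_Berge ::
  "'a set set \<Rightarrow> nat set \<Rightarrow> nat set \<Rightarrow> (nat \<Rightarrow> nat set) \<Rightarrow> bool" where
  "contains_Berge H V E ends \<longleftrightarrow>
     (\<exists>phi :: nat \<Rightarrow> 'a. \<exists>f :: nat \<Rightarrow> 'a set.
        inj_on phi V \<and> inj_on f E \<and> f ` E \<subseteq> H \<and>
        (\<forall>e\<in>E. phi ` ends e \<subseteq> f e))"

definition C2_free :: "'a set set \<Rightarrow> bool" where
  "C2_free H \<longleftrightarrow> \<not> contains_Berge H {0,1} {0,1} (\<lambda>_. {0,1})"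

definition C3_free :: "'a set set \<Rightarrow> bool" where
  "C3_free H \<longleftrightarrow> \<not> contains_Berge H {0,1,2} {0,1,2}
      (\<lambda>e. if e = 0 then {0,1} else if e = 1 then {1,2} else {0,2})"

text \<open>K_{2,3}: parts {0,1} and {2,3,4}; edge label 3*i+j joins i and 2+j.\<close>
definition K23_free :: "'a set set \<Rightarrow> bool" where
  "K23_free H \<longleftrightarrow> \<not> contains_Berge H {0..4} {0..5}
      (\<lambda>e. {e div 3, 2 + e mod 3})"

definition C2_C3_K23_free :: "'a set set \<Rightarrow> bool" where
  "C2_C3_K23_free H \<longleftrightarrow> C2_free H \<and> C3_free H \<and> K23_free H"

definition r_partite_hypergraph :: "nat \<Rightarrow> nat \<Rightarrow> (nat \<Rightarrow> 'a set) \<Rightarrow> 'a set set \<Rightarrow> bool" where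
  "r_partite_hypergraph r n P H \<longleftrightarrow>
     (\<forall>i<r. finite (P i) \<and> card (P i) = n) \<and>
     (\<forall>i<r. \<forall>j<r. i \<noteq> j \<longrightarrow> P i \<inter> P j = {}) \<and>
     (\<forall>e\<in>H. e \<subseteq> (\<Union>i<r. P i) \<and> card e = r \<and> (\<forall>i<r. card (e \<inter> P i) = 1))"

definition odd_prime_power :: "nat \<Rightarrow> bool" where
  "odd_prime_power q \<longleftrightarrow> (\<exists>p k. prime p \<and> odd p \<and> k \<ge> 1 \<and> q = p ^ k)"

end

theory Submission
  imports Defs "HOL-Library.Nat_Bijection" "Jordan_Normal_Form.Char_Poly"
begin

text \<open>Upper bound: two vertices of one part have at most two common neighbours in the other parts,
  since three of them would give a Berge copy of \<open>K\<^sub>2\<^sub>,\<^sub>3\<close>, unless two of the six edges coincide, and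
  this produces a Berge copy of \<open>C\<^sub>2\<close> or \<open>C\<^sub>3\<close>. Counting pairs of distinct edges through a vertex
  outside the first part gives \<open>\<Sum> d(x) (d(x) - 1) \<le> 2 n (n - 1)\<close>, where the degrees \<open>d(x)\<close> have
  sum \<open>(r - 1) |H|\<close>; by Cauchy-Schwarz \<open>|H| (|H| - n) \<le> 2 n\<^sup>3 / (r - 1)\<close>.

  Construction: each part is a copy of the plane over a field of order \<open>q\<close>, and the edges are the
  three-term progressions \<open>g, g + s(a), g + 2 s(a)\<close> with \<open>s(a) = (a, a\<^sup>2)\<close>, the \<open>i\<close>-th term being
  taken in the \<open>i\<close>-th part. A triangle would be a line meeting the parabola three times, and the
  common neighbours of two vertices correspond to the roots of a linear or quadratic equation. All
  \<open>q\<^sup>3\<close> progressions may be used; a subfamily of the required size suffices.\<close>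

section \<open>Freeness in terms of vertices and edges\<close>

text \<open>The definition asks for two maps on numeric labels; here vertices and edges are
  quantified one by one, and list indexing supplies the maps. The characterisations of
  \<open>C3_free\<close> and \<open>K23_free\<close> follow the same pattern.\<close>

lemma C2_free_iff:
  "C2_free H \<longleftrightarrow> (\<forall>e\<in>H. \<forall>f\<in>H. \<forall>x y. x \<noteq> y \<and> {x, y} \<subseteq> e \<inter> f \<longrightarrow> e = f)"
proof
  assume free: "C2_free H"
  show "\<forall>e\<in>H. \<forall>f\<in>H. \<forall>x y. x \<noteq> y \<and> {x, y} \<subseteq> e \<inter> f \<longrightarrow> e = f"
  proof (intro ballI allI impI, rule ccontr)
    fix e f x y
    assume "e \<in> H" "f \<in> H" "x \<noteq> y \<and> {x, y} \<subseteq> e \<inter> f" "e \<noteq> f"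
    then have "contains_Berge H {0,1} {0,1} (\<lambda>_. {0,1})"
      unfolding contains_Berge_def
      by (intro exI[of _ "(!) [x, y]"] exI[of _ "(!) [e, f]"]) auto
    with free show False
      by (simp add: C2_free_def)
  qed
next
  assume *: "\<forall>e\<in>H. \<forall>f\<in>H. \<forall>x y. x \<noteq> y \<and> {x, y} \<subseteq> e \<inter> f \<longrightarrow> e = f"
  show "C2_free H"
    unfolding C2_free_def contains_Berge_def
  proof (rule notI, elim exE conjE)
    fix phi :: "nat \<Rightarrow> 'a" and f :: "nat \<Rightarrow> 'a set"
    assume "inj_on phi {0,1}" "inj_on f {0,1}" "f ` {0,1} \<subseteq> H" "\<forall>e\<in>{0,1}. phi ` {0,1} \<subseteq> f e"
    then show False
      using *[rule_format, of "f 0" "f 1" "phi 0" "phi 1"] by auto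
  qed
qed

lemma C3_free_iff:
  "C3_free H \<longleftrightarrow> (\<forall>e\<in>H. \<forall>f\<in>H. \<forall>g\<in>H. \<forall>x y z. distinct [x, y, z] \<and>
     {x, y} \<subseteq> e \<and> {y, z} \<subseteq> f \<and> {x, z} \<subseteq> g \<longrightarrow> \<not> distinct [e, f, g])"
proof
  assume free: "C3_free H"
  show "\<forall>e\<in>H. \<forall>f\<in>H. \<forall>g\<in>H. \<forall>x y z. distinct [x, y, z] \<and>
     {x, y} \<subseteq> e \<and> {y, z} \<subseteq> f \<and> {x, z} \<subseteq> g \<longrightarrow> \<not> distinct [e, f, g]"
  proof (intro ballI allI impI notI)
    fix e f g x y z
    assume "e \<in> H" "f \<in> H" "g \<in> H" "distinct [x, y, z] \<and>
      {x, y} \<subseteq> e \<and> {y, z} \<subseteq> f \<and> {x, z} \<subseteq> g" "distinct [e, f, g]"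
    then have "contains_Berge H {0,1,2} {0,1,2}
      (\<lambda>e. if e = 0 then {0,1} else if e = 1 then {1,2} else {0,2})"
      unfolding contains_Berge_def
      by (intro exI[of _ "(!) [x, y, z]"] exI[of _ "(!) [e, f, g]"]) (auto simp: numeral_2_eq_2)
    with free show False
      by (simp add: C3_free_def)
  qed
next
  assume *: "\<forall>e\<in>H. \<forall>f\<in>H. \<forall>g\<in>H. \<forall>x y z. distinct [x, y, z] \<and>
     {x, y} \<subseteq> e \<and> {y, z} \<subseteq> f \<and> {x, z} \<subseteq> g \<longrightarrow> \<not> distinct [e, f, g]"
  show "C3_free H"
    unfolding C3_free_def contains_Berge_def
  proof (rule notI, elim exE conjE)
    fix phi :: "nat \<Rightarrow> 'a" and f :: "nat \<Rightarrow> 'a set"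
    assume "inj_on phi {0,1,2}" "inj_on f {0,1,2}" "f ` {0,1,2} \<subseteq> H"
      "\<forall>e\<in>{0,1,2}. phi ` (if e = 0 then {0,1} else if e = 1 then {1,2} else {0,2}) \<subseteq> f e"
    then show False
      using *[rule_format, of "f 0" "f 1" "f 2" "phi 0" "phi 1" "phi 2"] by auto
  qed
qed

lemma K23_free_iff:
  "K23_free H \<longleftrightarrow> (\<forall>x y z1 z2 z3 e1 e2 e3 f1 f2 f3. distinct [x, y, z1, z2, z3] \<and>
     {e1, e2, e3, f1, f2, f3} \<subseteq> H \<and>
     {x, z1} \<subseteq> e1 \<and> {x, z2} \<subseteq> e2 \<and> {x, z3} \<subseteq> e3 \<and>
     {y, z1} \<subseteq> f1 \<and> {y, z2} \<subseteq> f2 \<and> {y, z3} \<subseteq> f3 \<longrightarrow> \<not> distinct [e1, e2, e3, f1, f2, f3])"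
  (is "_ \<longleftrightarrow> ?R")
proof
  have sets: "{0..4::nat} = {0,1,2,3,4}" "{0..5::nat} = {0,1,2,3,4,5}"
    by auto
  { assume free: "K23_free H"
    show ?R
    proof (intro allI impI notI)
      fix x y z1 z2 z3 e1 e2 e3 f1 f2 f3
      assume "distinct [x, y, z1, z2, z3] \<and> {e1, e2, e3, f1, f2, f3} \<subseteq> H \<and>
         {x, z1} \<subseteq> e1 \<and> {x, z2} \<subseteq> e2 \<and> {x, z3} \<subseteq> e3 \<and>
         {y, z1} \<subseteq> f1 \<and> {y, z2} \<subseteq> f2 \<and> {y, z3} \<subseteq> f3" "distinct [e1, e2, e3, f1, f2, f3]"
      note H = this
      let ?phi = "(!) [x, y, z1, z2, z3]" and ?f = "(!) [e1, e2, e3, f1, f2, f3]"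
      have "inj_on ?phi {0..4}"
        using H by (intro inj_on_nth) auto
      moreover have "inj_on ?f {0..5}"
        by (intro inj_on_nth H) auto
      moreover have "?f ` {0..5} \<subseteq> H"
        using H unfolding sets by simp
      moreover have "\<forall>e\<in>{0..5}. ?phi ` {e div 3, 2 + e mod 3} \<subseteq> ?f e"
        using H unfolding sets by simp
      ultimately have "contains_Berge H {0..4} {0..5} (\<lambda>e. {e div 3, 2 + e mod 3})"
        unfolding contains_Berge_def by blast
      with free show False
        by (simp add: K23_free_def)
    qed }
  assume *: ?R
  show "K23_free H"
    unfolding K23_free_def contains_Berge_def sets
  proof (rule notI, elim exE conjE)
    fix phi :: "nat \<Rightarrow> 'a" and f :: "nat \<Rightarrow> 'a set"
    assume phi: "inj_on phi {0,1,2,3,4}" and f: "inj_on f {0,1,2,3,4,5}" "f ` {0,1,2,3,4,5} \<subseteq> H"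
      and ends: "\<forall>e\<in>{0,1,2,3,4,5}. phi ` {e div 3, 2 + e mod 3} \<subseteq> f e"
    have edge: "{phi i, phi j} \<subseteq> f e" if "e \<in> {0,1,2,3,4,5}" "e div 3 = i" "2 + e mod 3 = j" for e i j
      using ends that(1) unfolding that(2,3)[symmetric] by blast
    have "distinct [phi 0, phi 1, phi 2, phi 3, phi 4]"
      using phi by simp
    moreover have "{f 0, f 1, f 2, f 3, f 4, f 5} \<subseteq> H"
      using f(2) by simp
    moreover have "{phi 0, phi 2} \<subseteq> f 0" "{phi 0, phi 3} \<subseteq> f 1" "{phi 0, phi 4} \<subseteq> f 2"
      "{phi 1, phi 2} \<subseteq> f 3" "{phi 1, phi 3} \<subseteq> f 4" "{phi 1, phi 4} \<subseteq> f 5"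
      by (rule edge; simp)+
    ultimately have "\<not> distinct [f 0, f 1, f 2, f 3, f 4, f 5]"
      by (intro *[rule_format] conjI)
    with f(1) show False
      by simp
  qed
qed

text \<open>A Berge copy found in a subfamily is also one in the whole family. This allows edges of
  the construction to be discarded until their number is the prescribed one.\<close>

lemma C2_C3_K23_free_subset:
  assumes "C2_C3_K23_free H" "H' \<subseteq> H"
  shows "C2_C3_K23_free H'"
proof -
  have "contains_Berge H V E ends" if "contains_Berge H' V E ends" for V E ends
    using that \<open>H' \<subseteq> H\<close> unfolding contains_Berge_def by (meson subset_trans)
  then show ?thesis
    using assms by (auto simp: C2_C3_K23_free_def C2_free_def C3_free_def K23_free_def)
qed

section \<open>Upper bound\<close>

text \<open>If \<open>e1 = e2\<close>, this edge contains both \<open>x1\<close> and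
  \<open>x2\<close>. Then either \<open>f1 = f2\<close> shares these two vertices with it, a
  Berge-\<open>C\<^sub>2\<close>, or \<open>f1\<close>, \<open>e1\<close>, \<open>f2\<close> form a
  Berge triangle on \<open>b\<close>, \<open>x1\<close>, \<open>x2\<close>.\<close>

lemma common_neighbour_edges_distinct:
  assumes lin: "C2_free H" and tri: "C3_free H"
    and edges: "e1 \<in> H" "e2 \<in> H" "f1 \<in> H" "f2 \<in> H"
    and inc: "x1 \<in> e1" "x2 \<in> e2" "{b, x1} \<subseteq> f1" "{b, x2} \<subseteq> f2"
    and dist: "distinct [b, x1, x2]" and neq: "e1 \<noteq> f1" "e1 \<noteq> f2"
  shows "e1 \<noteq> e2"
proof
  assume "e1 = e2"
  then have x: "{x1, x2} \<subseteq> e1"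
    using inc by simp
  show False
  proof (cases "f1 = f2")
    case True
    then have "{x1, x2} \<subseteq> e1 \<inter> f1"
      using x inc by auto
    then show False
      using lin[unfolded C2_free_iff, rule_format, of e1 f1 x1 x2] edges dist neq by auto
  next
    case False
    then show False
      using tri[unfolded C3_free_iff, rule_format, of f1 e1 f2 b x1 x2] x edges inc dist neq by auto
  qed
qed

text \<open>Three common neighbours of \<open>a\<close> and \<open>b\<close> would give a Berge-\<open>K\<^sub>2\<^sub>,\<^sub>3\<close>: two of the six edges can
  coincide only at the cost of a Berge-\<open>C\<^sub>2\<close> or a Berge-\<open>C\<^sub>3\<close>.\<close>

lemma no_three_common_neighbours:
  assumes free: "C2_C3_K23_free H"
    and edges: "{e1, e2, e3, f1, f2, f3} \<subseteq> H"
    and inc: "{a, x1} \<subseteq> e1" "{a, x2} \<subseteq> e2" "{a, x3} \<subseteq> e3" "{b, x1} \<subseteq> f1" "{b, x2} \<subseteq> f2" "{b, x3} \<subseteq> f3"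
    and dist: "distinct [a, b, x1, x2, x3]"
    and neq: "\<And>e f. e \<in> {e1, e2, e3} \<Longrightarrow> f \<in> {f1, f2, f3} \<Longrightarrow> e \<noteq> f"
  shows False
proof -
  have lin: "C2_free H" and tri: "C3_free H" and "K23_free H"
    using free by (auto simp: C2_C3_K23_free_def)
  note D = common_neighbour_edges_distinct[OF lin tri]
  have neq': "e1 \<noteq> f1" "e1 \<noteq> f2" "e1 \<noteq> f3" "e2 \<noteq> f1" "e2 \<noteq> f2" "e2 \<noteq> f3"
    "e3 \<noteq> f1" "e3 \<noteq> f2" "e3 \<noteq> f3"
    by (rule neq; simp)+
  have "e1 \<noteq> e2"
    by (rule D[of _ _ f1 f2 x1 x2 b]) (use edges inc dist neq' in simp_all)
  moreover have "e1 \<noteq> e3"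
    by (rule D[of _ _ f1 f3 x1 x3 b]) (use edges inc dist neq' in simp_all)
  moreover have "e2 \<noteq> e3"
    by (rule D[of _ _ f2 f3 x2 x3 b]) (use edges inc dist neq' in simp_all)
  moreover have "f1 \<noteq> f2"
    by (rule D[of _ _ e1 e2 x1 x2 a]) (use edges inc dist neq' in simp_all)
  moreover have "f1 \<noteq> f3"
    by (rule D[of _ _ e1 e3 x1 x3 a]) (use edges inc dist neq' in simp_all)
  moreover have "f2 \<noteq> f3"
    by (rule D[of _ _ e2 e3 x2 x3 a]) (use edges inc dist neq' in simp_all)
  ultimately have "distinct [e1, e2, e3, f1, f2, f3]"
    using neq' by simp
  moreover have "\<not> distinct [e1, e2, e3, f1, f2, f3]"
    using \<open>K23_free H\<close>[unfolded K23_free_iff, rule_format, of a b x1 x2 x3 e1 e2 e3 f1 f2 f3]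
      edges inc dist by simp
  ultimately show False
    by blast
qed

text \<open>This expands \<open>0 \<le> (\<Sum>x\<in>X. (f x - c)\<^sup>2)\<close>. With
  \<open>c\<close> the mean of \<open>f\<close> on \<open>X\<close> it is the Cauchy-Schwarz bound
  for the sum of squares.\<close>

lemma sum_squares_ge_mean:
  fixes f :: "'b \<Rightarrow> real"
  shows "2 * c * sum f X - real (card X) * c\<^sup>2 \<le> (\<Sum>x\<in>X. (f x)\<^sup>2)"
proof -
  have "0 \<le> (\<Sum>x\<in>X. (f x - c)\<^sup>2)"
    by (intro sum_nonneg) simp
  also have "\<dots> = (\<Sum>x\<in>X. (f x)\<^sup>2) - 2 * c * sum f X + real (card X) * c\<^sup>2"
  proof -
    have "(f x - c)\<^sup>2 = (f x)\<^sup>2 - (2 * c) * f x + c\<^sup>2" for x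
      by (simp add: power2_diff)
    then show ?thesis
      by (simp only: sum.distrib sum_subtractf sum_distrib_left[symmetric] sum_constant)
  qed
  finally show ?thesis
    by simp
qed

lemma card_off_diagonal:
  assumes "finite D"
  shows "card {(a, b). a \<in> D \<and> b \<in> D \<and> a \<noteq> b} = card D * card D - card D"
proof -
  have "{(a, b). a \<in> D \<and> b \<in> D \<and> a \<noteq> b} = D \<times> D - (\<lambda>a. (a, a)) ` D"
    by auto
  moreover have "card ((\<lambda>a. (a, a)) ` D) = card D"
    by (intro card_image inj_onI) simp
  ultimately show ?thesis
    using assms by (simp add: card_Diff_subset image_subset_iff card_cartesian_product)
qed

section \<open>Counting pairs of edges through a vertex\<close>

locale free_partite_hypergraph =
  fixes r n :: nat and P :: "nat \<Rightarrow> 'a set" and H :: "'a set set"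
  assumes r: "r \<ge> 3" and partite: "r_partite_hypergraph r n P H" and free: "C2_C3_K23_free H"
begin

definition other_parts :: "'a set" where
  "other_parts = (\<Union>i\<in>{1..<r}. P i)"

text \<open>Meaningful for edges only: they meet part 0 in a singleton.\<close>

definition anchor :: "'a set \<Rightarrow> 'a" where
  "anchor e = the_elem (e \<inter> P 0)"

lemma finite_part: "i < r \<Longrightarrow> finite (P i)"
  and card_P: "i < r \<Longrightarrow> card (P i) = n"
  and disjoint_P: "i < r \<Longrightarrow> j < r \<Longrightarrow> i \<noteq> j \<Longrightarrow> P i \<inter> P j = {}"
  and edge_subset: "e \<in> H \<Longrightarrow> e \<subseteq> (\<Union>i<r. P i)"
  and card_edge: "e \<in> H \<Longrightarrow> card e = r"
  and card_edge_P: "e \<in> H \<Longrightarrow> i < r \<Longrightarrow> card (e \<inter> P i) = 1"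
  using partite unfolding r_partite_hypergraph_def by auto

lemma finite_H: "finite H"
proof (rule finite_subset)
  show "H \<subseteq> Pow (\<Union>i<r. P i)"
    using edge_subset by blast
  show "finite (Pow (\<Union>i<r. P i))"
    using finite_part by auto
qed

lemma anchor:
  assumes "e \<in> H"
  shows "e \<inter> P 0 = {anchor e}" "anchor e \<in> e" "anchor e \<in> P 0"
proof -
  have "card (e \<inter> P 0) = 1"
    using card_edge_P[OF assms, of 0] r by simp
  then obtain y where "e \<inter> P 0 = {y}"
    using card_1_singletonE by blast
  then show *: "e \<inter> P 0 = {anchor e}"
    by (simp add: anchor_def)
  then show "anchor e \<in> e" "anchor e \<in> P 0"
    by blast+
qed

lemma finite_other_parts: "finite other_parts"
  unfolding other_parts_def using finite_part by auto

lemma card_other_parts: "card other_parts = (r - 1) * n"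
proof -
  have "card other_parts = (\<Sum>i\<in>{1..<r}. card (P i))"
    unfolding other_parts_def by (intro card_UN_disjoint) (use finite_part disjoint_P in auto)
  then show ?thesis
    using card_P by simp
qed

lemma other_parts_disjoint: "other_parts \<inter> P 0 = {}"
  unfolding other_parts_def using disjoint_P[of _ 0] by fastforce

lemma card_edge_other_parts:
  assumes "e \<in> H"
  shows "card {x \<in> other_parts. x \<in> e} = r - 1"
proof -
  have "{..<r} = insert 0 {1..<r}"
    using r by auto
  then have e: "e = insert (anchor e) {x \<in> other_parts. x \<in> e}"
    using edge_subset[OF assms] anchor[OF assms] unfolding other_parts_def by auto
  have "anchor e \<notin> {x \<in> other_parts. x \<in> e}"
    using anchor(3)[OF assms] other_parts_disjoint by auto
  then have "card (insert (anchor e) {x \<in> other_parts. x \<in> e}) = Suc (card {x \<in> other_parts. x \<in> e})"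
    by (intro card_insert_disjoint) (simp_all add: finite_other_parts)
  then have "card e = Suc (card {x \<in> other_parts. x \<in> e})"
    unfolding e[symmetric] .
  then show ?thesis
    using card_edge[OF assms] by simp
qed

definition vertex_degree :: "'a \<Rightarrow> nat" where
  "vertex_degree x = card {e \<in> H. x \<in> e}"

text \<open>Incidences counted from the edges: each edge has \<open>r - 1\<close> vertices outside
  part 0.\<close>

lemma sum_degree: "(\<Sum>x\<in>other_parts. vertex_degree x) = card H * (r - 1)"
proof -
  have "(\<Sum>x\<in>other_parts. vertex_degree x) = (\<Sum>e\<in>H. r - 1)"
    unfolding vertex_degree_def
    by (intro sum_multicount_gen finite_other_parts finite_H) (auto simp: card_edge_other_parts)
  then show ?thesis
    by simp
qed

text \<open>The common anchor lies in part 0 and \<open>x\<close> does not, so the edges share two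
  vertices and linearity applies. An edge is thus determined by its anchor and one further
  vertex.\<close>

lemma same_edge:
  assumes "e \<in> H" "f \<in> H" "x \<in> e \<inter> f" "x \<in> other_parts" "anchor e = anchor f"
  shows "e = f"
proof -
  have "anchor e \<noteq> x"
    using anchor(3)[OF assms(1)] assms(4) other_parts_disjoint by auto
  moreover have "{anchor e, x} \<subseteq> e \<inter> f"
    using anchor(2)[OF assms(1)] anchor(2)[OF assms(2)] assms by auto
  moreover have "C2_free H"
    using free by (simp add: C2_C3_K23_free_def)
  ultimately show ?thesis
    using assms(1,2) unfolding C2_free_iff by blast
qed

text \<open>The ordered pairs of distinct edges are tagged with a common vertex \<open>x\<close>, so
  that they can be counted in two ways: by \<open>x\<close>, which yields the degrees, and by the
  two anchors.\<close>

definition cherries :: "('a \<times> 'a set \<times> 'a set) set" where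
  "cherries = (SIGMA x:other_parts. {(e, f). e \<in> {e \<in> H. x \<in> e} \<and> f \<in> {e \<in> H. x \<in> e} \<and> e \<noteq> f})"

lemma card_cherries: "card cherries = (\<Sum>x\<in>other_parts. vertex_degree x * vertex_degree x - vertex_degree x)"
proof -
  have "finite {(e, f). e \<in> {e \<in> H. x \<in> e} \<and> f \<in> {e \<in> H. x \<in> e} \<and> e \<noteq> f}" for x
    by (rule finite_subset[of _ "H \<times> H"]) (use finite_H in auto)
  then have "card cherries = (\<Sum>x\<in>other_parts.
      card {(e, f). e \<in> {e \<in> H. x \<in> e} \<and> f \<in> {e \<in> H. x \<in> e} \<and> e \<noteq> f})"
    unfolding cherries_def by (intro card_SigmaI finite_other_parts) auto
  also have "\<dots> = (\<Sum>x\<in>other_parts. vertex_degree x * vertex_degree x - vertex_degree x)"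
    unfolding vertex_degree_def by (intro sum.cong refl card_off_diagonal) (use finite_H in auto)
  finally show ?thesis .
qed

text \<open>The centre of a cherry is a common neighbour of its two anchors, and different cherries
  over \<open>a\<close> and \<open>b\<close> have different centres. Three of them would contradict
  \<open>no_three_common_neighbours\<close>.\<close>

lemma card_cherries_over:
  assumes "a \<noteq> b"
  shows "card {(x, e, f) \<in> cherries. anchor e = a \<and> anchor f = b} \<le> 2" (is "card ?F \<le> 2")
proof (rule ccontr)
  assume "\<not> card ?F \<le> 2"
  then obtain T where "T \<subseteq> ?F" "card T = 3"
    using obtain_subset_with_card_n[of 3 ?F] by auto
  then obtain s1 s2 s3 where s: "T = {s1, s2, s3}" "s1 \<noteq> s2" "s1 \<noteq> s3" "s2 \<noteq> s3"
    unfolding card_3_iff by blast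
  moreover obtain x1 e1 f1 where "s1 = (x1, e1, f1)"
    by (cases s1)
  moreover obtain x2 e2 f2 where "s2 = (x2, e2, f2)"
    by (cases s2)
  moreover obtain x3 e3 f3 where "s3 = (x3, e3, f3)"
    by (cases s3)
  ultimately have T: "T = {(x1, e1, f1), (x2, e2, f2), (x3, e3, f3)}"
    and dist: "(x1, e1, f1) \<noteq> (x2, e2, f2)" "(x1, e1, f1) \<noteq> (x3, e3, f3)" "(x2, e2, f2) \<noteq> (x3, e3, f3)"
    by simp_all
  have S: "(x1, e1, f1) \<in> ?F" "(x2, e2, f2) \<in> ?F" "(x3, e3, f3) \<in> ?F"
    using T \<open>T \<subseteq> ?F\<close> by auto
  have F: "x \<in> other_parts" "e \<in> H" "f \<in> H" "x \<in> e" "x \<in> f" "anchor e = a" "anchor f = b"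
    if "(x, e, f) \<in> ?F" for x e f
    using that by (auto simp: cherries_def)
  have ab: "a \<in> e" "b \<in> f" "a \<in> P 0" "b \<in> P 0" if "(x, e, f) \<in> ?F" for x e f
    using F[OF that] anchor by auto
  \<comment> \<open>By \<open>same_edge\<close> the centre and the two anchors determine both edges,
    so distinct cherries over \<open>a\<close> and \<open>b\<close> have distinct centres.\<close>
  have eqI: "(x, e, f) = (x', e', f')"
    if "(x, e, f) \<in> ?F" "(x', e', f') \<in> ?F" "x = x'" for x e f x' e' f'
    using F[OF that(1)] F[OF that(2)] that(3) same_edge[of e e' x] same_edge[of f f' x] by auto
  have x: "x1 \<noteq> x2" "x1 \<noteq> x3" "x2 \<noteq> x3"
    using eqI[OF S(1,2)] eqI[OF S(1,3)] eqI[OF S(2,3)] dist by blast+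
  have notin: "x1 \<notin> P 0" "x2 \<notin> P 0" "x3 \<notin> P 0"
    using F(1)[OF S(1)] F(1)[OF S(2)] F(1)[OF S(3)] other_parts_disjoint by blast+
  show False
  proof (rule no_three_common_neighbours[OF free])
    show "{e1, e2, e3, f1, f2, f3} \<subseteq> H"
      using F(2,3)[OF S(1)] F(2,3)[OF S(2)] F(2,3)[OF S(3)] by blast
    show "{a, x1} \<subseteq> e1" "{b, x1} \<subseteq> f1"
      using F(4,5)[OF S(1)] ab[OF S(1)] by blast+
    show "{a, x2} \<subseteq> e2" "{b, x2} \<subseteq> f2"
      using F(4,5)[OF S(2)] ab[OF S(2)] by blast+
    show "{a, x3} \<subseteq> e3" "{b, x3} \<subseteq> f3"
      using F(4,5)[OF S(3)] ab[OF S(3)] by blast+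
    show "distinct [a, b, x1, x2, x3]"
      using x notin ab(3,4)[OF S(1)] assms by auto
    \<comment> \<open>The two edges have different anchors, \<open>a\<close> and
      \<open>b\<close>.\<close>
    show "e \<noteq> f" if "e \<in> {e1, e2, e3}" "f \<in> {f1, f2, f3}" for e f
      using that F(6,7)[OF S(1)] F(6,7)[OF S(2)] F(6,7)[OF S(3)] assms by blast
  qed
qed

text \<open>The anchors of a cherry differ, since otherwise \<open>same_edge\<close> would identify
  its two edges. Hence only the \<open>n * n - n\<close> ordered pairs of distinct vertices of part
  0 occur, each at most twice.\<close>

lemma card_cherries_le: "card cherries \<le> 2 * (n * n - n)"
proof -
  let ?B = "{(a, b). a \<in> P 0 \<and> b \<in> P 0 \<and> a \<noteq> b}"
  let ?F = "\<lambda>(a, b). {(x, e, f) \<in> cherries. anchor e = a \<and> anchor f = b}"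
  have P0: "finite (P 0)" "card (P 0) = n"
    using finite_part[of 0] card_P[of 0] r by auto
  have fin_B: "finite ?B"
    by (rule finite_subset[of _ "P 0 \<times> P 0"]) (use P0 in auto)
  have "cherries = (\<Union>c\<in>?B. ?F c)"
  proof
    show "cherries \<subseteq> (\<Union>c\<in>?B. ?F c)"
    proof
      fix s assume s: "s \<in> cherries"
      obtain x e f where s_eq: "s = (x, e, f)"
        by (cases s)
      have "x \<in> other_parts" "e \<in> H" "f \<in> H" "x \<in> e" "x \<in> f" "e \<noteq> f"
        using s unfolding s_eq cherries_def by auto
      then have "(anchor e, anchor f) \<in> ?B"
        using anchor(3) same_edge[of e f x] by auto
      moreover have "s \<in> ?F (anchor e, anchor f)"
        using s s_eq by simp
      ultimately show "s \<in> (\<Union>c\<in>?B. ?F c)"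
        by (rule UN_I)
    qed
  qed auto
  then have "card cherries \<le> (\<Sum>c\<in>?B. card (?F c))"
    using card_UN_le[OF fin_B, of ?F] by simp
  also have "\<dots> \<le> (\<Sum>c\<in>?B. 2)"
  proof (rule sum_mono)
    fix c assume "c \<in> ?B"
    then obtain a b where "c = (a, b)" "a \<noteq> b"
      by auto
    then show "card (?F c) \<le> 2"
      using card_cherries_over[of a b] by simp
  qed
  also have "\<dots> = 2 * (n * n - n)"
    using card_off_diagonal[OF P0(1)] P0(2) by simp
  finally show ?thesis .
qed

section \<open>From the count of pairs to the bound on the number of edges\<close>

lemma card_edges_quadratic_bound:
  assumes "n > 0"
  shows "(real r - 1) * (real (card H))\<^sup>2 \<le> (real r - 1) * real (card H) * real n + 2 * real n ^ 3"
proof -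
  define m where "m = real (card H)"
  define R where "R = real r - 1"
  have R: "real (r - 1) = R"
    using r by (simp add: R_def)
  have sum: "(\<Sum>x\<in>other_parts. real (vertex_degree x)) = m * R"
    using arg_cong[OF sum_degree, of real] unfolding of_nat_sum of_nat_mult R m_def .
  have "real (card cherries) = (\<Sum>x\<in>other_parts. (real (vertex_degree x))\<^sup>2) - m * R"
    unfolding card_cherries sum[symmetric]
    by (simp add: of_nat_diff power2_eq_square sum_subtractf)
  moreover have "real (card cherries) \<le> 2 * (real n)\<^sup>2"
  proof -
    have "card cherries \<le> 2 * n\<^sup>2"
      using card_cherries_le by (simp add: power2_eq_square)
    then show ?thesis
      using of_nat_mono by fastforce
  qed
  \<comment> \<open>The choice \<open>c = m / n\<close> is the mean degree: the degrees sum to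
    \<open>m * R\<close> over \<open>R * n\<close> vertices.\<close>
  moreover have "2 * (m / n) * (m * R) - (R * real n) * (m / n)\<^sup>2 \<le> (\<Sum>x\<in>other_parts. (real (vertex_degree x))\<^sup>2)"
    using sum_squares_ge_mean[of "m / n" "\<lambda>x. real (vertex_degree x)" other_parts]
    unfolding sum card_other_parts of_nat_mult R .
  moreover have "2 * (m / n) * (m * R) - (R * real n) * (m / n)\<^sup>2 = R * m\<^sup>2 / n"
    using assms by (simp add: field_simps power2_eq_square)
  ultimately have "R * m\<^sup>2 / n \<le> m * R + 2 * (real n)\<^sup>2"
    by simp
  then have "R * m\<^sup>2 \<le> (m * R + 2 * (real n)\<^sup>2) * n"
    using assms by (simp add: pos_divide_le_eq)
  then show ?thesis
    by (simp add: m_def R_def algebra_simps power2_eq_square power3_eq_cube)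
qed

lemma card_edges_upper_bound:
  "real (card H) \<le> sqrt (2 / (real r - 1)) * real n powr (3/2) + real n"
proof (cases "n = 0")
  case True
  \<comment> \<open>Empty parts leave no possible anchor, hence no edge; the other case divides by
    \<open>n\<close>.\<close>
  then have "P 0 = {}"
    using card_P[of 0] finite_part[of 0] r by simp
  then have "H = {}"
    using anchor(3) by blast
  with True show ?thesis
    by simp
next
  case False
  define m where "m = real (card H)"
  \<comment> \<open>With this \<open>t\<close> the quadratic bound becomes
    \<open>m * (m - n) \<le> t * t\<close>, and \<open>m > t + n\<close> would make both factors on
    the left larger than \<open>t\<close>.\<close>
  define t where "t = sqrt (2 / (real r - 1)) * real n powr (3/2)"
  have t: "t \<ge> 0"
    unfolding t_def using r by (intro mult_nonneg_nonneg) auto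
  have "(real n powr (3/2))\<^sup>2 = real n ^ 3"
    using False by (simp add: powr_power powr_numeral)
  then have t_sq: "(real r - 1) * t\<^sup>2 = 2 * real n ^ 3"
    using r by (simp add: t_def power_mult_distrib)
  have "(real r - 1) * m\<^sup>2 \<le> (real r - 1) * m * real n + 2 * real n ^ 3"
    using card_edges_quadratic_bound False by (simp add: m_def)
  then have "(real r - 1) * m\<^sup>2 \<le> (real r - 1) * (m * real n + t\<^sup>2)"
    using t_sq by (simp add: distrib_left mult.assoc)
  then have "m\<^sup>2 \<le> m * real n + t\<^sup>2"
    using r by (subst (asm) mult_le_cancel_left_pos) auto
  then have le: "m * (m - real n) \<le> t * t"
    by (simp add: power2_eq_square algebra_simps)
  have "m \<le> t + real n"
  proof (rule ccontr)
    assume "\<not> m \<le> t + real n"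
    then have "t * t < m * (m - real n)"
      using t by (intro mult_strict_mono) auto
    with le show False
      by simp
  qed
  then show ?thesis
    by (simp add: m_def t_def)
qed

end

section \<open>A finite field as a quotient of a ring of complex numbers\<close>

text \<open>Rings and ideals are kept as subsets of one ambient ring, and congruence modulo an ideal
  is membership of the difference; no quotient type is formed.\<close>

definition unital_subring :: "'a::comm_ring_1 set \<Rightarrow> bool" where
  "unital_subring R \<longleftrightarrow> 1 \<in> R \<and> (\<forall>x\<in>R. \<forall>y\<in>R. x - y \<in> R \<and> x * y \<in> R)"

lemma unital_subringD:
  assumes "unital_subring R"
  shows "1 \<in> R" "0 \<in> R"
    and "\<And>x y. x \<in> R \<Longrightarrow> y \<in> R \<Longrightarrow> x - y \<in> R"
    and "\<And>x y. x \<in> R \<Longrightarrow> y \<in> R \<Longrightarrow> x + y \<in> R"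
    and "\<And>x y. x \<in> R \<Longrightarrow> y \<in> R \<Longrightarrow> x * y \<in> R"
    and "\<And>x. x \<in> R \<Longrightarrow> - x \<in> R"
    and "\<And>x n. x \<in> R \<Longrightarrow> x ^ n \<in> R"
    and "\<And>n. of_nat n \<in> R"
proof -
  show one: "1 \<in> R" and diff: "\<And>x y. x \<in> R \<Longrightarrow> y \<in> R \<Longrightarrow> x - y \<in> R"
    and mult: "\<And>x y. x \<in> R \<Longrightarrow> y \<in> R \<Longrightarrow> x * y \<in> R"
    using assms by (auto simp: unital_subring_def)
  show zero: "0 \<in> R"
    using diff[OF one one] by simp
  show uminus: "- x \<in> R" if "x \<in> R" for x
    using diff[OF zero that] by simp
  show add: "x + y \<in> R" if "x \<in> R" "y \<in> R" for x y
    using diff[OF that(1) uminus[OF that(2)]] by simp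
  show "x ^ n \<in> R" if "x \<in> R" for x n
    by (induction n) (use one mult that in auto)
  show "of_nat n \<in> R" for n
    by (induction n) (use zero one add in auto)
qed

lemma unital_subring_sum:
  assumes "unital_subring R" "\<And>i. i \<in> I \<Longrightarrow> f i \<in> R"
  shows "sum f I \<in> R"
  using assms(2)
  by (induction I rule: infinite_finite_induct) (auto intro: unital_subringD[OF assms(1)])

definition ideal_in :: "'a::comm_ring_1 set \<Rightarrow> 'a set \<Rightarrow> bool" where
  "ideal_in R I \<longleftrightarrow> 0 \<in> I \<and> I \<subseteq> R \<and> (\<forall>x\<in>I. \<forall>y\<in>I. x + y \<in> I) \<and> (\<forall>a\<in>R. \<forall>x\<in>I. a * x \<in> I)"

lemma ideal_inD:
  assumes "ideal_in R I"
  shows "0 \<in> I" "I \<subseteq> R"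
    and "\<And>x y. x \<in> I \<Longrightarrow> y \<in> I \<Longrightarrow> x + y \<in> I"
    and "\<And>a x. a \<in> R \<Longrightarrow> x \<in> I \<Longrightarrow> a * x \<in> I"
    and "\<And>a x. a \<in> R \<Longrightarrow> x \<in> I \<Longrightarrow> x * a \<in> I"
  using assms by (auto simp: ideal_in_def mult.commute)

lemma ideal_in_diff:
  assumes "unital_subring R" "ideal_in R I" "x \<in> I" "y \<in> I"
  shows "x - y \<in> I"
proof -
  have "- 1 * y \<in> I"
    by (intro ideal_inD(4)[OF assms(2)] unital_subringD(1,6)[OF assms(1)] assms(4))
  from ideal_inD(3)[OF assms(2,3) this] show ?thesis
    by simp
qed

text \<open>Zorn's lemma gives a maximal element \<open>M\<close> among the proper ideals containing
  \<open>I\<close>, and a maximal ideal is prime.\<close>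

lemma exists_prime_ideal:
  assumes R: "unital_subring R" and I: "ideal_in R I" and "1 \<notin> I"
  obtains M where "ideal_in R M" "I \<subseteq> M" "1 \<notin> M"
    "\<And>x y. x \<in> R \<Longrightarrow> y \<in> R \<Longrightarrow> x * y \<in> M \<Longrightarrow> x \<in> M \<or> y \<in> M"
proof -
  define \<A> where "\<A> = {M. ideal_in R M \<and> I \<subseteq> M \<and> 1 \<notin> M}"
  have "\<A> \<noteq> {}"
    using I \<open>1 \<notin> I\<close> by (auto simp: \<A>_def)
  moreover have "\<Union>\<C> \<in> \<A>" if "\<C> \<noteq> {}" and chain: "subset.chain \<A> \<C>" for \<C>
  proof -
    have sub: "\<C> \<subseteq> \<A>"
      using chain by (auto simp: subset.chain_def)
    have "x + y \<in> \<Union>\<C>" if "x \<in> \<Union>\<C>" "y \<in> \<Union>\<C>" for x y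
    proof -
      obtain X Y where XY: "X \<in> \<C>" "x \<in> X" "Y \<in> \<C>" "y \<in> Y"
        using \<open>x \<in> \<Union>\<C>\<close> \<open>y \<in> \<Union>\<C>\<close> by blast
      obtain Z where "Z \<in> \<C>" "x \<in> Z" "y \<in> Z"
        using subset_chain_def chain XY by (metis in_mono)
      then show ?thesis
        using sub unfolding \<A>_def ideal_in_def by blast
    qed
    moreover have "0 \<in> \<Union>\<C>" "I \<subseteq> \<Union>\<C>"
      using \<open>\<C> \<noteq> {}\<close> sub by (auto simp: \<A>_def ideal_in_def)
    moreover have "\<Union>\<C> \<subseteq> R" "1 \<notin> \<Union>\<C>" "\<And>a x. a \<in> R \<Longrightarrow> x \<in> \<Union>\<C> \<Longrightarrow> a * x \<in> \<Union>\<C>"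
      using sub unfolding \<A>_def ideal_in_def by blast+
    ultimately show ?thesis
      by (auto simp: \<A>_def ideal_in_def)
  qed
  ultimately have "\<exists>M\<in>\<A>. \<forall>X\<in>\<A>. M \<subseteq> X \<longrightarrow> X = M"
    by (rule subset_Zorn_nonempty)
  then obtain M where M: "M \<in> \<A>" and max: "\<And>X. X \<in> \<A> \<Longrightarrow> M \<subseteq> X \<Longrightarrow> X = M"
    by blast
  have idM: "ideal_in R M" and "I \<subseteq> M" "1 \<notin> M"
    using M by (auto simp: \<A>_def)
  note RD = unital_subringD[OF R] and MD = ideal_inD[OF idM]
  have "x \<in> M \<or> y \<in> M" if "x \<in> R" "y \<in> R" "x * y \<in> M" for x y
  proof (rule disjCI)
    assume "y \<notin> M"
    \<comment> \<open>This is the ideal generated by \<open>M\<close> and \<open>y\<close>. By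
      maximality it contains \<open>1\<close>, and multiplying \<open>1 = m + a * y\<close> by
      \<open>x\<close> puts \<open>x\<close> into \<open>M\<close>.\<close>
    define X where "X = {m + a * y |m a. m \<in> M \<and> a \<in> R}"
    have "m \<in> X" if "m \<in> M" for m
      using that RD(2) by (force simp: X_def)
    then have "M \<subseteq> X"
      by blast
    moreover have "y \<in> X"
      using MD(1) RD(1) by (force simp: X_def)
    moreover have "u + v \<in> X" if "u \<in> X" "v \<in> X" for u v
    proof -
      obtain m a m' a' where "u = m + a * y" "v = m' + a' * y"
        and mem: "m \<in> M" "a \<in> R" "m' \<in> M" "a' \<in> R"
        using \<open>u \<in> X\<close> \<open>v \<in> X\<close> by (auto simp: X_def)
      then have "u + v = (m + m') + (a + a') * y"
        by (simp add: algebra_simps)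
      then show ?thesis
        unfolding X_def using MD(3) RD(4) mem by blast
    qed
    moreover have "b * u \<in> X" if "b \<in> R" "u \<in> X" for b u
    proof -
      obtain m a where "u = m + a * y" and mem: "m \<in> M" "a \<in> R"
        using \<open>u \<in> X\<close> by (auto simp: X_def)
      then have "b * u = b * m + (b * a) * y"
        by (simp add: algebra_simps)
      then show ?thesis
        unfolding X_def using MD(4) RD(5) mem \<open>b \<in> R\<close> by blast
    qed
    moreover have "X \<subseteq> R"
      using MD(2) RD(4,5) \<open>y \<in> R\<close> by (auto simp: X_def)
    ultimately have "ideal_in R X" "I \<subseteq> X" "X \<noteq> M"
      using MD(1) \<open>I \<subseteq> M\<close> \<open>y \<notin> M\<close> unfolding ideal_in_def by blast+
    then have "1 \<in> X"
      using max \<open>M \<subseteq> X\<close> by (auto simp: \<A>_def)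
    then obtain m a where "1 = m + a * y" and mem: "m \<in> M" "a \<in> R"
      by (auto simp: X_def)
    then have "x = x * m + a * (x * y)"
      by (metis distrib_left mult.left_commute mult.right_neutral)
    also have "\<dots> \<in> M"
      using MD(3,4) mem that by blast
    finally show "x \<in> M" .
  qed
  with that idM \<open>I \<subseteq> M\<close> \<open>1 \<notin> M\<close> show thesis
    by blast
qed

section \<open>The ring generated by the roots of unity\<close>

text \<open>For \<open>n > 0\<close> this is the ring of integer polynomials in a primitive
  \<open>n\<close>-th root of unity. All \<open>n\<close> roots serve as generators, so the
  coefficients \<open>c\<close> are in general not unique.\<close>

definition roots_unity_span :: "nat \<Rightarrow> complex set" where
  "roots_unity_span n = range (\<lambda>c :: complex \<Rightarrow> int. \<Sum>w | w ^ n = 1. of_int (c w) * w)"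

text \<open>Multiplication by \<open>u\<close> permutes the roots of unity, so it only reindexes the
  coefficients. This yields both closure under products and the integer matrix of multiplication by
  an element of the span.\<close>

lemma root_unity_mult_span:
  fixes u :: complex
  assumes "u ^ n = 1" "n > 0"
  shows "u * (\<Sum>w | w ^ n = 1. of_int (c w) * w) = (\<Sum>w | w ^ n = 1. of_int (c (w / u)) * w)"
proof -
  have "u \<noteq> 0"
    using assms by (auto simp: power_0_left)
  then show ?thesis
    unfolding sum_distrib_left
    by (intro sum.reindex_bij_witness[of _ "\<lambda>w. w / u" "\<lambda>w. u * w"])
       (use assms in \<open>auto simp: power_mult_distrib power_divide\<close>)
qed

lemma unital_subring_roots_unity_span:
  assumes "n > 0"
  shows "unital_subring (roots_unity_span n)" "{w. w ^ n = 1} \<subseteq> roots_unity_span n"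
proof -
  let ?W = "{w::complex. w ^ n = 1}" and ?s = "\<lambda>c :: complex \<Rightarrow> int. \<Sum>w | w ^ n = 1. of_int (c w) * w"
  have fin: "finite ?W"
    using assms by (intro finite_roots_unity) auto
  have diff: "?s c - ?s d \<in> roots_unity_span n" for c d
    unfolding roots_unity_span_def
    by (rule range_eqI[of _ _ "\<lambda>w. c w - d w"]) (simp add: algebra_simps sum_subtractf)
  have smult: "of_int a * ?s c \<in> roots_unity_span n" for a c
    unfolding roots_unity_span_def
    by (rule range_eqI[of _ _ "\<lambda>w. a * c w"]) (simp add: algebra_simps sum_distrib_left)
  have rmult: "u * ?s c \<in> roots_unity_span n" if "u ^ n = 1" for u c
    using root_unity_mult_span[OF that assms] by (auto simp: roots_unity_span_def)
  have diff': "x - y \<in> roots_unity_span n" if "x \<in> roots_unity_span n" "y \<in> roots_unity_span n" for x y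
    using that diff unfolding roots_unity_span_def by fast
  have zero: "0 \<in> roots_unity_span n"
    using diff[of "\<lambda>_. 0" "\<lambda>_. 0"] by simp
  have add: "x + y \<in> roots_unity_span n" if "x \<in> roots_unity_span n" "y \<in> roots_unity_span n" for x y
    using diff'[OF that(1) diff'[OF zero that(2)]] by simp
  have sum: "sum f I \<in> roots_unity_span n" if "\<And>i. i \<in> I \<Longrightarrow> f i \<in> roots_unity_span n"
    for f :: "complex \<Rightarrow> complex" and I
    using that by (induction I rule: infinite_finite_induct) (auto intro: zero add)
  have mult: "?s c * ?s d \<in> roots_unity_span n" for c d
  proof -
    have "?s c * ?s d = (\<Sum>w\<in>?W. of_int (c w) * (w * ?s d))"
      by (simp only: sum_distrib_right mult.assoc)
    also have "\<dots> \<in> roots_unity_span n"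
    proof (rule sum)
      fix w assume "w \<in> ?W"
      then show "of_int (c w) * (w * ?s d) \<in> roots_unity_span n"
        using rmult[of w d] smult by (auto simp: roots_unity_span_def)
    qed
    finally show ?thesis .
  qed
  show W: "?W \<subseteq> roots_unity_span n"
  proof
    fix u assume "u \<in> ?W"
    then have "u = ?s (\<lambda>w. if w = u then 1 else 0)"
      using fin by (simp add: if_distrib[of of_int] if_distrib[of "\<lambda>x. x * _"] sum.delta cong: if_cong)
    then show "u \<in> roots_unity_span n"
      by (auto simp: roots_unity_span_def)
  qed
  have "1 \<in> roots_unity_span n"
    using W by auto
  moreover have "x * y \<in> roots_unity_span n" if "x \<in> roots_unity_span n" "y \<in> roots_unity_span n" for x y
    using that mult unfolding roots_unity_span_def by fast
  ultimately show "unital_subring (roots_unity_span n)"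
    using diff' unfolding unital_subring_def by blast
qed

text \<open>Multiplication by \<open>x\<close> acts on the vector of all roots of unity by an integer matrix, so \<open>x\<close>
  is a root of the characteristic polynomial of that matrix.\<close>

lemma algebraic_int_roots_unity_span:
  assumes "x \<in> roots_unity_span n" "n > 0"
  shows "algebraic_int x"
proof -
  let ?W = "{w::complex. w ^ n = 1}"
  obtain c :: "complex \<Rightarrow> int" where x: "x = (\<Sum>w\<in>?W. of_int (c w) * w)"
    using assms(1) by (auto simp: roots_unity_span_def)
  have "finite ?W" "card ?W = n"
    using assms(2) by (intro finite_roots_unity card_roots_unity_eq; simp)+
  then obtain b where b: "bij_betw b {0..<n} ?W"
    using ex_bij_betw_nat_finite[of ?W] by auto
  \<comment> \<open>Row \<open>i\<close> lists the coefficients of \<open>b i * x\<close>: by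
    \<open>root_unity_mult_span\<close>, the root \<open>b j\<close> occurs there with coefficient
    \<open>c (b j / b i)\<close>.\<close>
  define A where "A = mat n n (\<lambda>(i, j). c (b j / b i))"
  define v where "v = vec n b"
  let ?A = "map_mat (of_int :: int \<Rightarrow> complex) A"
  have A: "A \<in> carrier_mat n n" "?A \<in> carrier_mat n n"
    by (auto simp: A_def)
  have unity: "b i ^ n = 1" if "i < n" for i
    using bij_betw_apply[OF b, of i] that by auto
  have "?A *\<^sub>v v = x \<cdot>\<^sub>v v"
  proof (rule eq_vecI)
    fix i assume "i < dim_vec (x \<cdot>\<^sub>v v)"
    then have i: "i < n"
      by (simp add: v_def)
    have "(?A *\<^sub>v v) $ i = (\<Sum>j\<in>{0..<n}. of_int (c (b j / b i)) * b j)"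
      using i by (simp add: A_def v_def scalar_prod_def)
    also have "\<dots> = (\<Sum>w\<in>?W. of_int (c (w / b i)) * w)"
      by (rule sum.reindex_bij_betw[OF b])
    also have "\<dots> = b i * x"
      unfolding x using root_unity_mult_span[OF unity[OF i] assms(2)] by simp
    finally show "(?A *\<^sub>v v) $ i = (x \<cdot>\<^sub>v v) $ i"
      using i by (simp add: v_def mult.commute)
  qed (use A in \<open>auto simp: v_def\<close>)
  moreover have "v \<noteq> 0\<^sub>v n"
  proof
    assume "v = 0\<^sub>v n"
    then have "b 0 = 0"
      using assms(2) by (metis index_vec index_zero_vec(1) v_def)
    with unity[of 0] assms(2) show False
      by (simp add: power_0_left)
  qed
  ultimately have "eigenvalue ?A x"
    unfolding eigenvalue_def eigenvector_def using A
    by (intro exI[of _ v]) (auto simp: v_def)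
  then have "poly (char_poly ?A) x = 0"
    using eigenvalue_root_char_poly[OF A(2)] by blast
  then have "poly (map_poly of_int (char_poly A)) x = 0"
    by (simp add: of_int_hom.char_poly_hom[OF A(1)])
  moreover have "lead_coeff (char_poly A) = 1"
    using degree_monic_char_poly[OF A(1)] by auto
  ultimately show ?thesis
    by (auto simp: algebraic_int_altdef_ipoly)
qed

text \<open>As polynomials in \<open>x\<close>, both sides are monic of degree \<open>n\<close> and
  vanish at the \<open>n\<close> roots of unity, so they coincide.\<close>

lemma prod_diff_roots_unity:
  fixes x :: complex
  assumes "n > 0"
  shows "(\<Prod>w | w ^ n = 1. x - w) = x ^ n - 1"
proof -
  let ?W = "{w::complex. w ^ n = 1}"
  have W: "finite ?W" "card ?W = n"
    using assms by (intro finite_roots_unity card_roots_unity_eq; simp)+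
  have deg: "degree (\<Prod>w\<in>?W. [:- w, 1:]) = n"
    by (subst degree_prod_eq_sum_degree) (auto simp: W)
  have "lead_coeff (\<Prod>w\<in>?W. [:- w, 1:]) = 1"
    by (simp add: lead_coeff_prod)
  then have "(\<Prod>w\<in>?W. [:- w, 1:]) = monom 1 n - 1"
    by (intro poly_eqI_degree_lead_coeff[of _ n _ ?W])
       (use assms deg W in \<open>auto simp: poly_prod poly_monom degree_monom_eq
          intro!: degree_diff_le prod_zero\<close>)
  then have "poly (\<Prod>w\<in>?W. [:- w, 1:]) x = poly (monom 1 n - 1) x"
    by simp
  then show ?thesis
    by (simp add: poly_prod poly_monom)
qed

section \<open>The Frobenius congruence and the field of order \<open>q\<close>\<close>

text \<open>For exponent \<open>p\<close> the inner binomial coefficients are multiples of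
  \<open>p\<close>. The induction on \<open>k\<close> raises the congruence for \<open>p ^ k\<close>
  to the \<open>p\<close>-th power, using that congruent elements have congruent powers.\<close>

lemma power_prime_add_cong:
  assumes R: "unital_subring R" and I: "ideal_in R I" and p: "prime p" "of_nat p \<in> I"
    and xy: "x \<in> R" "y \<in> R"
  shows "(x + y) ^ (p ^ k) - (x ^ (p ^ k) + y ^ (p ^ k)) \<in> I"
proof -
  note RD = unital_subringD[OF R] and ID = ideal_inD[OF I]
  have base: "(u + v) ^ p - (u ^ p + v ^ p) \<in> I" if uv: "u \<in> R" "v \<in> R" for u v
  proof -
    have "p > 0"
      using p prime_gt_0_nat by blast
    then have split: "{..p} = insert 0 (insert p {0<..<p})" "0 \<noteq> p"
      by auto
    have "(u + v) ^ p - (u ^ p + v ^ p) = (\<Sum>k\<in>{0<..<p}. of_nat (p choose k) * u ^ k * v ^ (p - k))"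
      unfolding binomial_ring by (subst split(1)) (use split(2) in simp)
    also have "\<dots> = of_nat p * (\<Sum>k\<in>{0<..<p}. of_nat ((p choose k) div p) * u ^ k * v ^ (p - k))"
    proof -
      have "(of_nat (p choose k) :: 'a) = of_nat p * of_nat ((p choose k) div p)" if "k \<in> {0<..<p}" for k
      proof -
        have "p dvd (p choose k)"
          using that p by (intro dvd_choose_prime) auto
        then show ?thesis
          by (simp flip: of_nat_mult)
      qed
      then show ?thesis
        by (simp add: sum_distrib_left mult.assoc)
    qed
    also have "\<dots> \<in> I"
      by (intro ID(5)[OF _ p(2)] unital_subring_sum[OF R] RD(5) RD(7) RD(8) uv)
    finally show ?thesis .
  qed
  have cong_power: "u ^ m - v ^ m \<in> I" if "u \<in> R" "v \<in> R" "u - v \<in> I" for u v m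
    unfolding power_diff_sumr2
    by (intro ID(5)[OF _ that(3)] unital_subring_sum[OF R] RD(5) RD(7) that)
  show ?thesis
  proof (induction k)
    case 0
    then show ?case
      using ID(1) by simp
  next
    case (Suc k)
    let ?q = "p ^ k"
    have "((x + y) ^ ?q) ^ p - (x ^ ?q + y ^ ?q) ^ p \<in> I"
      by (intro cong_power Suc RD(4) RD(7) xy)
    moreover have "(x ^ ?q + y ^ ?q) ^ p - ((x ^ ?q) ^ p + (y ^ ?q) ^ p) \<in> I"
      by (intro base RD(7) xy)
    ultimately have "((x + y) ^ ?q) ^ p - (x ^ ?q + y ^ ?q) ^ p
        + ((x ^ ?q + y ^ ?q) ^ p - ((x ^ ?q) ^ p + (y ^ ?q) ^ p)) \<in> I"
      by (rule ID(3))
    then have "((x + y) ^ ?q) ^ p - ((x ^ ?q) ^ p + (y ^ ?q) ^ p) \<in> I"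
      by (simp add: algebra_simps)
    then show ?case
      by (simp add: mult.commute flip: power_mult)
  qed
qed

text \<open>The quotient of \<open>A\<close> by \<open>M\<close> is an integral domain with
  \<open>q\<close> elements in which \<open>2\<close> is nonzero, hence a field of odd order.
  \<open>\<kappa>\<close> numbers its residue classes, so that vertices can be coded as natural
  numbers; instead of division, the arguments cancel factors outside \<open>M\<close>.\<close>

locale finite_quotient_domain =
  fixes A M :: "'a::comm_ring_1 set" and \<kappa> :: "'a \<Rightarrow> nat" and q :: nat
  assumes subring: "unital_subring A"
    and ideal: "ideal_in A M"
    and prime_ideal: "x \<in> A \<Longrightarrow> y \<in> A \<Longrightarrow> x * y \<in> M \<Longrightarrow> x \<in> M \<or> y \<in> M"
    and two: "2 \<notin> M"
    and code: "\<kappa> ` A = {..<q}"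
    and code_eq_iff: "x \<in> A \<Longrightarrow> y \<in> A \<Longrightarrow> \<kappa> x = \<kappa> y \<longleftrightarrow> x - y \<in> M"

text \<open>If \<open>z = u / v\<close> differs from \<open>1\<close>, its powers
  \<open>z ^ i\<close> for \<open>i < n\<close> sum to zero. Since \<open>z\<close> is congruent to
  \<open>1\<close>, the same sum is congruent to \<open>n\<close>, which would put \<open>n\<close>
  into \<open>I\<close>.\<close>

lemma roots_unity_distinct_mod:
  fixes R I :: "complex set" and u v :: complex
  assumes R: "unital_subring R" and I: "ideal_in R I" and n: "of_nat n \<notin> I" "n > 0"
    and W: "{w. w ^ n = 1} \<subseteq> R" and uv: "u ^ n = 1" "v ^ n = 1" "u - v \<in> I"
  shows "u = v"
proof (rule ccontr)
  assume "u \<noteq> v"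
  note RD = unital_subringD[OF R] and ID = ideal_inD[OF I]
  have nz: "v \<noteq> 0"
    using uv n by (auto simp: power_0_left)
  define z where "z = u / v"
  have z: "z ^ n = 1" "z \<noteq> 1"
    using uv nz \<open>u \<noteq> v\<close> by (auto simp: z_def power_divide)
  have "z \<in> R" "inverse v \<in> R"
    using W z uv by (auto simp: power_inverse)
  then have "z - 1 \<in> I"
    using ID(4)[OF _ uv(3), of "inverse v"] nz by (simp add: z_def field_simps)
  have "(\<Sum>i<n. z ^ i) = 0"
    using geometric_sum[OF z(2), of n] z(1) by simp
  moreover have "(\<Sum>i<n. z ^ i - 1) \<in> I"
  proof -
    have "z ^ i - 1 \<in> I" for i
      unfolding power_diff_1_eq
      by (intro ID(5)[OF _ \<open>z - 1 \<in> I\<close>] unital_subring_sum[OF R] RD(7) \<open>z \<in> R\<close>)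
    then show ?thesis
      by (induction n) (auto intro: ID(1) ID(3))
  qed
  ultimately have "- of_nat n \<in> I"
    by (simp add: sum_subtractf)
  then have "- 1 * (- of_nat n) \<in> I"
    by (intro ID(4) RD(1) RD(6))
  with n show False
    by simp
qed

text \<open>The field of order \<open>q\<close> arises by adjoining the \<open>(q - 1)\<close>-th roots of unity to the integers and
  reducing modulo a prime ideal above \<open>p\<close>: in the residue ring, \<open>x ^ q - x\<close> is the product of
  the \<open>x - a\<close> with \<open>a\<close> zero or a root of unity, and its zero set is closed under addition by the
  Frobenius identity.\<close>

lemma exists_finite_quotient_domain:
  assumes "odd_prime_power q"
  obtains A M :: "complex set" and \<kappa> where "finite_quotient_domain A M \<kappa> q"
proof -
  obtain p k where p: "prime p" "odd p" "k \<ge> 1" and q: "q = p ^ k"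
    using assms by (auto simp: odd_prime_power_def)
  define n where "n = q - 1"
  have "p > 1"
    using p prime_gt_1_nat by blast
  then have "q > 1"
    using p one_less_power[of p k] by (simp add: q)
  then have n: "n > 0" "q = Suc n"
    unfolding n_def by simp_all
  have "odd q"
    using p by (simp add: q)
  define R where "R = roots_unity_span n"
  let ?W = "{w::complex. w ^ n = 1}"
  have R: "unital_subring R" and W: "?W \<subseteq> R"
    using unital_subring_roots_unity_span n by (auto simp: R_def)
  note RD = unital_subringD[OF R]
  define I where "I = (\<lambda>x. of_nat p * x) ` R"
  have "a + x \<in> I" if "a \<in> I" "x \<in> I" for a x
  proof -
    obtain b y where "a = of_nat p * b" "x = of_nat p * y" "b \<in> R" "y \<in> R"
      using \<open>a \<in> I\<close> \<open>x \<in> I\<close> by (auto simp: I_def)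
    then have "a + x = of_nat p * (b + y)" "b + y \<in> R"
      using RD(4) by (simp_all add: algebra_simps)
    then show ?thesis
      by (auto simp: I_def)
  qed
  moreover have "a * x \<in> I" if "a \<in> R" "x \<in> I" for a x
  proof -
    obtain y where "x = of_nat p * y" "y \<in> R"
      using \<open>x \<in> I\<close> by (auto simp: I_def)
    then have "a * x = of_nat p * (a * y)" "a * y \<in> R"
      using RD(5) \<open>a \<in> R\<close> by simp_all
    then show ?thesis
      by (auto simp: I_def)
  qed
  moreover have "0 \<in> I"
    using RD(2) by (force simp: I_def)
  moreover have "I \<subseteq> R"
    using RD(5,8) by (auto simp: I_def)
  ultimately have "ideal_in R I"
    unfolding ideal_in_def by blast
  \<comment> \<open>Otherwise \<open>1 / p\<close> would lie in \<open>R\<close>; being a rational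
    algebraic integer it would be an integer.\<close>
  moreover have "1 \<notin> I"
  proof
    assume "1 \<in> I"
    then obtain x where x: "1 = of_nat p * x" "x \<in> R"
      by (auto simp: I_def)
    then have "algebraic_int x"
      using algebraic_int_roots_unity_span n by (auto simp: R_def)
    moreover have "x = 1 / of_nat p"
      using x \<open>p > 1\<close> by (auto simp: field_simps)
    then have "x \<in> \<rat>"
      by auto
    ultimately have "x \<in> \<int>"
      using rational_algebraic_int_is_int by blast
    then obtain i where "x = of_int i"
      by (auto elim: Ints_cases)
    with x(1) have "of_int 1 = (of_int (int p * i) :: complex)"
      by simp
    then have "int p * i = 1"
      using of_int_eq_iff by metis
    then have "int p dvd 1"
      by (metis dvd_triv_left)
    then show False
      using \<open>p > 1\<close> by simp
  qed
  ultimately obtain M where M: "ideal_in R M" "I \<subseteq> M" "1 \<notin> M"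
    and prime: "\<And>x y. x \<in> R \<Longrightarrow> y \<in> R \<Longrightarrow> x * y \<in> M \<Longrightarrow> x \<in> M \<or> y \<in> M"
    using exists_prime_ideal[OF R] by blast
  note MD = ideal_inD[OF M(1)] and Mdiff = ideal_in_diff[OF R M(1)]
  have "of_nat p * 1 \<in> I"
    unfolding I_def using RD(1) by blast
  then have pM: "of_nat p \<in> M"
    using M(2) by auto
  have dvd_M: "of_nat m \<in> M" if "p dvd m" for m
    using that MD(5)[OF RD(8) pM] by (auto elim!: dvdE)
  \<comment> \<open>\<open>m\<close> and \<open>m + 1\<close> cannot both lie in the proper ideal
    \<open>M\<close>. This is applied to \<open>m = q - 1\<close> and to
    \<open>p - 1\<close>.\<close>
  have succ_M: "of_nat m \<notin> M" if "p dvd Suc m" for m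
    using Mdiff[OF dvd_M[OF that], of "of_nat m"] M(3) by auto
  \<comment> \<open>The elements fixed by the \<open>q\<close>-th power map modulo \<open>M\<close>
    form a subring with exactly \<open>q\<close> residue classes, represented by the elements of
    \<open>F\<close>.\<close>
  define A where "A = {x \<in> R. x ^ q - x \<in> M}"
  define F where "F = insert 0 ?W"
  have "F \<subseteq> A"
    using W RD(2) MD(1) n by (auto simp: F_def A_def)
  have subA: "unital_subring A"
    unfolding unital_subring_def
  proof (intro conjI ballI)
    show "1 \<in> A"
      using RD(1) MD(1) by (auto simp: A_def)
    fix x y assume "x \<in> A" "y \<in> A"
    then have xy: "x \<in> R" "y \<in> R" "x ^ q - x \<in> M" "y ^ q - y \<in> M"
      by (auto simp: A_def)
    \<comment> \<open>Closure under subtraction is the Frobenius congruence; as \<open>q\<close> is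
      odd, \<open>(- y) ^ q\<close> equals \<open>- (y ^ q)\<close>.\<close>
    have "(x + (- y)) ^ q - (x ^ q + (- y) ^ q) \<in> M"
      unfolding q by (intro power_prime_add_cong[OF R M(1) p(1) pM] xy RD(6))
    then have "((x + (- y)) ^ q - (x ^ q + (- y) ^ q)) + ((x ^ q - x) - (y ^ q - y)) \<in> M"
      by (rule MD(3)[OF _ Mdiff[OF xy(3,4)]])
    then have "(x - y) ^ q - (x - y) \<in> M"
      using \<open>odd q\<close> by (simp add: algebra_simps)
    then show "x - y \<in> A"
      using xy RD(3) by (auto simp: A_def)
    have "x ^ q * (y ^ q - y) + y * (x ^ q - x) \<in> M"
      by (intro MD(3) MD(4) RD(7) xy)
    then have "(x * y) ^ q - x * y \<in> M"
      by (simp add: algebra_simps)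
    then show "x * y \<in> A"
      using xy RD(5) by (auto simp: A_def)
  qed
  note AD = unital_subringD[OF subA]
  have W': "finite ?W" "card ?W = n"
    using n by (intro finite_roots_unity card_roots_unity_eq; simp)+
  have F: "finite F" "card F = q"
    using W' n by (auto simp: F_def power_0_left)
  \<comment> \<open>Since \<open>M\<close> is prime, it contains one of the linear factors of
    \<open>x ^ q - x\<close>.\<close>
  have rep: "\<exists>f\<in>F. x - f \<in> M" if "x \<in> A" for x
  proof -
    have x: "x \<in> R"
      using that by (simp add: A_def)
    have "x * (\<Prod>w\<in>?W. x - w) = x ^ q - x"
      unfolding prod_diff_roots_unity[OF n(1)] using n(2) by (simp add: algebra_simps)
    then have "x * (\<Prod>w\<in>?W. x - w) \<in> M"
      using that by (auto simp: A_def)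
    moreover have prod_R: "(\<Prod>w\<in>S. x - w) \<in> R" if "S \<subseteq> ?W" for S
      using that by (induction S rule: infinite_finite_induct) (use RD(1,3,5) x W in auto)
    ultimately consider "x \<in> M" | "(\<Prod>w\<in>?W. x - w) \<in> M"
      using prime x by blast
    then show ?thesis
    proof cases
      case 2
      have "\<exists>w\<in>S. x - w \<in> M" if "finite S" "S \<subseteq> ?W" "(\<Prod>w\<in>S. x - w) \<in> M" for S
        using that
      proof (induction S rule: finite_induct)
        case (insert w S)
        then have "x - w \<in> M \<or> (\<Prod>w\<in>S. x - w) \<in> M"
          using prod_R x W RD(3) by (intro prime) auto
        with insert show ?case
          by auto
      qed (use M(3) in auto)
      from this[OF W'(1) _ 2] show ?thesis
        by (auto simp: F_def)
    qed (auto simp: F_def)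
  qed
  \<comment> \<open>A root of unity is a unit, so it is not congruent to zero. Two distinct ones
    stay incongruent because \<open>n + 1 = q\<close> is a multiple of \<open>p\<close>, which keeps
    \<open>n\<close> outside \<open>M\<close>.\<close>
  have distinct: "f = g" if "f \<in> F" "g \<in> F" "f - g \<in> M" for f g
  proof -
    have unit: "u \<notin> M" if "u \<in> ?W" for u
    proof
      assume "u \<in> M"
      have "u ^ (n - 1) * u \<in> M"
        using that W \<open>u \<in> M\<close> by (intro MD(4) RD(7)) auto
      then have "u ^ n \<in> M"
        using n power_Suc2[of u "n - 1"] by auto
      with that M(3) show False
        by simp
    qed
    have "p dvd Suc n"
      using p(3) by (simp flip: n(2) add: q dvd_power)
    then have "of_nat n \<notin> M"
      by (rule succ_M)
    note eq = roots_unity_distinct_mod[OF R M(1) this n(1) W]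
    have "g - f \<in> M"
      using Mdiff[OF MD(1) that(3)] by simp
    with that show ?thesis
      using unit[of f] unit[of g] eq[of f g] by (auto simp: F_def)
  qed
  obtain h where h: "bij_betw h F {0..<q}"
    using ex_bij_betw_finite_nat[OF F(1)] F(2) by auto
  define rp where "rp x = (SOME f. f \<in> F \<and> x - f \<in> M)" for x
  have rp: "rp x \<in> F" "x - rp x \<in> M" if "x \<in> A" for x
    using someI_ex[of "\<lambda>f. f \<in> F \<and> x - f \<in> M"] rep[OF that] by (auto simp: rp_def)
  have rp_eq: "rp x = rp y \<longleftrightarrow> x - y \<in> M" if "x \<in> A" "y \<in> A" for x y
  proof
    assume "rp x = rp y"
    then show "x - y \<in> M"
      using Mdiff[OF rp(2)[OF that(1)] rp(2)[OF that(2)]] by simp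
  next
    assume "x - y \<in> M"
    then have "(x - y) - (x - rp x) + (y - rp y) \<in> M"
      by (intro MD(3)[OF Mdiff[OF _ rp(2)[OF that(1)]] rp(2)[OF that(2)]])
    then have "rp x - rp y \<in> M"
      by simp
    then show "rp x = rp y"
      using distinct rp that by blast
  qed
  have rp_F: "rp f = f" if "f \<in> F" for f
    using distinct rp[of f] that \<open>F \<subseteq> A\<close> Mdiff[OF MD(1)] by (metis in_mono minus_diff_eq diff_0)
  have "rp ` A = F"
    using rp(1) rp_F \<open>F \<subseteq> A\<close> by force
  have "finite_quotient_domain A (M \<inter> A) (h \<circ> rp) q"
  proof
    show "unital_subring A"
      by fact
    show "ideal_in A (M \<inter> A)"
      unfolding ideal_in_def using MD(1,3,4) AD(2,4,5) by (auto simp: A_def)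
    show "x \<in> M \<inter> A \<or> y \<in> M \<inter> A" if "x \<in> A" "y \<in> A" "x * y \<in> M \<inter> A" for x y
      using prime[of x y] that by (auto simp: A_def)
    show "2 \<notin> M \<inter> A"
    proof
      assume two: "2 \<in> M \<inter> A"
      \<comment> \<open>If \<open>2\<close> were in \<open>M\<close>, so would be
        \<open>2 * m = p - 1\<close>, contradicting \<open>succ_M\<close>.\<close>
      obtain m where "p = Suc (2 * m)"
        using p by (metis oddE Suc_eq_plus1)
      moreover have "of_nat m * 2 \<in> M"
        using two RD(8) by (intro MD(4)) auto
      ultimately show False
        using succ_M[of "2 * m"] by (simp add: mult.commute)
    qed
    show "(h \<circ> rp) ` A = {..<q}"
      using h \<open>rp ` A = F\<close> unfolding image_comp[symmetric] bij_betw_def atLeast0LessThan by metis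
    show "(h \<circ> rp) x = (h \<circ> rp) y \<longleftrightarrow> x - y \<in> M \<inter> A" if "x \<in> A" "y \<in> A" for x y
      using rp_eq[OF that] rp(1)[OF that(1)] rp(1)[OF that(2)] h AD(3)[OF that]
      by (auto simp: bij_betw_def inj_on_def)
  qed
  then show thesis
    by (rule that)
qed

section \<open>Construction\<close>

context finite_quotient_domain
begin

lemmas A_closed = unital_subringD[OF subring]
lemmas M_closed = ideal_inD(3,4)[OF ideal] ideal_in_diff[OF subring ideal]

lemma M_zero: "0 \<in> M"
  by (rule ideal_inD(1)[OF ideal])

lemma M_cancel: "x \<in> A \<Longrightarrow> y \<in> A \<Longrightarrow> x \<notin> M \<Longrightarrow> x * y \<in> M \<Longrightarrow> y \<in> M"
  using prime_ideal by blast

lemma M_diff_sym: "x - y \<in> M \<Longrightarrow> y - x \<in> M"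
  using M_closed(3)[OF M_zero, of "x - y"] by simp

lemma M_uminus: "x \<in> M \<Longrightarrow> - x \<in> M"
  using M_closed(3)[OF M_zero, of x] by simp

lemma one_notin: "1 \<notin> M"
  using M_closed(2)[of 2 1] A_closed(8)[of 2] two by auto

text \<open>The number of steps from the \<open>i\<close>-th to the \<open>j\<close>-th term of a
  progression, as a ring element.\<close>

definition part_diff :: "nat \<Rightarrow> nat \<Rightarrow> 'a" where
  "part_diff i j = of_nat j - of_nat i"

lemma part_diff_closed: "part_diff i j \<in> A"
  unfolding part_diff_def by (intro A_closed)

text \<open>Distinct indices below 3 differ by 1 or 2 up to sign, and both are nonzero modulo
  \<open>M\<close>: odd characteristic enters here.\<close>

lemma part_diff_notin:
  assumes "i < 3" "j < 3" "i \<noteq> j"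
  shows "part_diff i j \<notin> M"
proof -
  have "part_diff i j \<in> {1, -1, 2, -2}"
    using assms by (auto simp: part_diff_def less_Suc_eq numeral_3_eq_3)
  then show ?thesis
    using two one_notin M_uminus[of "-1"] M_uminus[of "-2"] by auto
qed

section \<open>Vertices and edges of the construction\<close>

text \<open>The code depends on the residue classes of the coordinates only; the index of the part
  keeps the three copies of the plane disjoint.\<close>

definition vertex :: "nat \<Rightarrow> 'a \<Rightarrow> 'a \<Rightarrow> nat" where
  "vertex i u u' = prod_encode (i, prod_encode (\<kappa> u, \<kappa> u'))"

lemma vertex_eq_iff:
  assumes "u \<in> A" "u' \<in> A" "w \<in> A" "w' \<in> A"
  shows "vertex i u u' = vertex j w w' \<longleftrightarrow> i = j \<and> u - w \<in> M \<and> u' - w' \<in> M"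
  using assms code_eq_iff by (simp add: vertex_def)

definition parabola_edge :: "'a \<Rightarrow> 'a \<Rightarrow> 'a \<Rightarrow> nat set" where
  "parabola_edge x y a = (\<lambda>i. vertex i (x + of_nat i * a) (y + of_nat i * a\<^sup>2)) ` {..<3}"

lemma parabola_edgeE:
  assumes "z \<in> parabola_edge x y a" "x \<in> A" "y \<in> A" "a \<in> A"
  obtains i u u' where "i < 3" "u \<in> A" "u' \<in> A" "z = vertex i u u'"
proof -
  obtain i where i: "i < 3" "z = vertex i (x + of_nat i * a) (y + of_nat i * a\<^sup>2)"
    using assms(1) by (auto simp: parabola_edge_def)
  show thesis
    by (rule that[OF i(1) _ _ i(2)]) (intro A_closed assms)+
qed

lemma mem_parabola_edge_iff:
  assumes "u \<in> A" "u' \<in> A" "x \<in> A" "y \<in> A" "a \<in> A"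
  shows "vertex i u u' \<in> parabola_edge x y a \<longleftrightarrow>
    i < 3 \<and> u - (x + of_nat i * a) \<in> M \<and> u' - (y + of_nat i * a\<^sup>2) \<in> M"
proof -
  have eq: "vertex i u u' = vertex j (x + of_nat j * a) (y + of_nat j * a\<^sup>2) \<longleftrightarrow>
    i = j \<and> u - (x + of_nat j * a) \<in> M \<and> u' - (y + of_nat j * a\<^sup>2) \<in> M" for j
    by (intro vertex_eq_iff assms A_closed)
  show ?thesis
    unfolding parabola_edge_def image_iff eq by blast
qed

text \<open>Subtracting the membership congruences of the two vertices eliminates the base point
  \<open>(x, y)\<close> and leaves conditions on the parameter \<open>a\<close> alone.\<close>

lemma parabola_edge_adjacent:
  assumes "{vertex i u u', vertex j w w'} \<subseteq> parabola_edge x y a"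
    and "u \<in> A" "u' \<in> A" "w \<in> A" "w' \<in> A" "x \<in> A" "y \<in> A" "a \<in> A"
  shows "part_diff i j * a - (w - u) \<in> M" "part_diff i j * a\<^sup>2 - (w' - u') \<in> M"
proof -
  have mem: "u - (x + of_nat i * a) \<in> M" "u' - (y + of_nat i * a\<^sup>2) \<in> M"
    "w - (x + of_nat j * a) \<in> M" "w' - (y + of_nat j * a\<^sup>2) \<in> M"
    using assms by (auto simp: mem_parabola_edge_iff)
  show "part_diff i j * a - (w - u) \<in> M"
    using M_closed(3)[OF mem(1,3)] by (simp add: part_diff_def algebra_simps)
  show "part_diff i j * a\<^sup>2 - (w' - u') \<in> M"
    using M_closed(3)[OF mem(2,4)] by (simp add: part_diff_def algebra_simps)
qed

text \<open>For \<open>i = j\<close> the factor \<open>part_diff i j\<close> is zero, so the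
  coordinates would be congruent and the vertices equal.\<close>

lemma adjacent_vertices_parts_neq:
  assumes "{vertex i u u', vertex j w w'} \<subseteq> parabola_edge x y a"
    and "vertex i u u' \<noteq> vertex j w w'"
    and "u \<in> A" "u' \<in> A" "w \<in> A" "w' \<in> A" "x \<in> A" "y \<in> A" "a \<in> A"
  shows "i \<noteq> j"
  using parabola_edge_adjacent[OF assms(1,3-)] assms M_diff_sym M_uminus
  by (auto simp: part_diff_def vertex_eq_iff)

lemma M_square_diff:
  assumes "a \<in> A" "b \<in> A" "a - b \<in> M"
  shows "a\<^sup>2 - b\<^sup>2 \<in> M"
proof -
  have "(a + b) * (a - b) \<in> M"
    by (intro M_closed(2) A_closed(4) assms)
  then show ?thesis
    by (simp add: power2_eq_square algebra_simps)
qed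

text \<open>An edge is determined by one vertex and the class of its parameter: going
  \<open>i\<close> steps back from the vertex recovers the base point modulo
  \<open>M\<close>.\<close>

lemma parabola_edge_eqI:
  assumes "z \<in> parabola_edge x y a" "z \<in> parabola_edge x' y' b" "a - b \<in> M"
    and mem: "x \<in> A" "y \<in> A" "a \<in> A" "x' \<in> A" "y' \<in> A" "b \<in> A"
  shows "parabola_edge x y a = parabola_edge x' y' b" "x - x' \<in> M" "y - y' \<in> M"
proof -
  obtain i u u' where z: "u \<in> A" "u' \<in> A" "z = vertex i u u'"
    using parabola_edgeE[OF assms(1) mem(1-3)] by blast
  have eqs: "u - (x + of_nat i * a) \<in> M" "u' - (y + of_nat i * a\<^sup>2) \<in> M"
    "u - (x' + of_nat i * b) \<in> M" "u' - (y' + of_nat i * b\<^sup>2) \<in> M"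
    using assms z by (auto simp: mem_parabola_edge_iff)
  have sq: "a\<^sup>2 - b\<^sup>2 \<in> M"
    by (rule M_square_diff) (use assms in auto)
  have scale: "of_nat k * (a - b) \<in> M" "of_nat k * (a\<^sup>2 - b\<^sup>2) \<in> M" for k
    using M_closed(2) A_closed(8) sq assms(3) by blast+
  show x: "x - x' \<in> M"
    using M_closed(3)[OF M_closed(3)[OF eqs(3,1)] scale(1)[of i]] by (simp add: algebra_simps)
  show y: "y - y' \<in> M"
    using M_closed(3)[OF M_closed(3)[OF eqs(4,2)] scale(2)[of i]] by (simp add: algebra_simps)
  have "vertex k (x + of_nat k * a) (y + of_nat k * a\<^sup>2) =
    vertex k (x' + of_nat k * b) (y' + of_nat k * b\<^sup>2)" for k
  proof -
    have "(x + of_nat k * a) - (x' + of_nat k * b) \<in> M" "(y + of_nat k * a\<^sup>2) - (y' + of_nat k * b\<^sup>2) \<in> M"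
      using M_closed(1)[OF x scale(1)[of k]] M_closed(1)[OF y scale(2)[of k]]
      by (simp_all add: algebra_simps)
    moreover have "x + of_nat k * a \<in> A" "y + of_nat k * a\<^sup>2 \<in> A"
      "x' + of_nat k * b \<in> A" "y' + of_nat k * b\<^sup>2 \<in> A"
      by (intro A_closed mem)+
    ultimately show ?thesis
      by (simp add: vertex_eq_iff)
  qed
  then show "parabola_edge x y a = parabola_edge x' y' b"
    by (simp add: parabola_edge_def)
qed

definition parabola_graph :: "nat set set" where
  "parabola_graph = {parabola_edge x y a |x y a. x \<in> A \<and> y \<in> A \<and> a \<in> A}"

lemma parabola_graphE:
  assumes "e \<in> parabola_graph"
  obtains x y a where "e = parabola_edge x y a" "x \<in> A" "y \<in> A" "a \<in> A"
  using assms unfolding parabola_graph_def by blast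

lemma parabola_graph_vertexE:
  assumes "e \<in> parabola_graph" "p \<in> e"
  obtains i u u' where "i < 3" "u \<in> A" "u' \<in> A" "p = vertex i u u'"
  using assms parabola_graphE parabola_edgeE by metis

lemma parabola_graph_adjacentE:
  assumes "e \<in> parabola_graph" "{p, s} \<subseteq> e" "p \<noteq> s"
    and "p = vertex i u u'" "u \<in> A" "u' \<in> A" "s = vertex j w w'" "w \<in> A" "w' \<in> A"
  obtains a where "a \<in> A" "i \<noteq> j"
    "part_diff i j * a - (w - u) \<in> M" "part_diff i j * a\<^sup>2 - (w' - u') \<in> M"
proof -
  obtain x y a where e: "e = parabola_edge x y a" "x \<in> A" "y \<in> A" "a \<in> A"
    using parabola_graphE[OF assms(1)] .
  have sub: "{vertex i u u', vertex j w w'} \<subseteq> parabola_edge x y a"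
    using assms e by simp
  show thesis
    by (rule that[OF e(4) adjacent_vertices_parts_neq[OF sub] parabola_edge_adjacent[OF sub]])
       (use assms e in auto)
qed

section \<open>Linearity and absence of triangles\<close>

text \<open>Two common vertices lie in different parts and prescribe the same step for both edges,
  so \<open>part_diff i j * (a - b)\<close> is in \<open>M\<close>. Cancelling the factor gives
  congruent parameters, and one shared vertex then identifies the edges.\<close>

lemma C2_free_parabola_graph: "C2_free parabola_graph"
  unfolding C2_free_iff
proof (intro ballI allI impI)
  fix e f p q
  assume "e \<in> parabola_graph" "f \<in> parabola_graph" and pq: "p \<noteq> q \<and> {p, q} \<subseteq> e \<inter> f"
  then obtain x y a x' y' b where e: "e = parabola_edge x y a" and f: "f = parabola_edge x' y' b"
    and mem: "x \<in> A" "y \<in> A" "a \<in> A" "x' \<in> A" "y' \<in> A" "b \<in> A"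
    by (auto simp: parabola_graph_def)
  obtain i u u' where p: "i < 3" "u \<in> A" "u' \<in> A" "p = vertex i u u'"
    using parabola_edgeE pq e mem by (metis insert_subset le_inf_iff)
  obtain j w w' where q: "j < 3" "w \<in> A" "w' \<in> A" "q = vertex j w w'"
    using parabola_edgeE pq e mem by (metis insert_subset le_inf_iff)
  have sub: "{vertex i u u', vertex j w w'} \<subseteq> parabola_edge x y a"
    "{vertex i u u', vertex j w w'} \<subseteq> parabola_edge x' y' b"
    using pq p q e f by auto
  have "i \<noteq> j"
    using adjacent_vertices_parts_neq[OF sub(1)] pq p q mem by blast
  have "part_diff i j * a - (w - u) \<in> M" "part_diff i j * b - (w - u) \<in> M"
    using parabola_edge_adjacent sub p q mem by blast+
  then have "part_diff i j * (a - b) \<in> M"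
    using M_closed(3) by (fastforce simp: algebra_simps)
  then have "a - b \<in> M"
    using M_cancel part_diff_notin[OF p(1) q(1) \<open>i \<noteq> j\<close>] part_diff_closed A_closed(3) mem by blast
  then show "e = f"
    using parabola_edge_eqI(1)[of p x y a x' y' b] pq e f mem by auto
qed

text \<open>Modulo \<open>M\<close>, with \<open>L\<close> and \<open>Q\<close> the expressions in the last two hypotheses,
  \<open>(d + e) Q - (L + 2 (d + e) c) L = d e (a - b)\<^sup>2\<close>: a chord of the parabola meets it only in its
  end points.\<close>

lemma parabola_convex_combination:
  assumes mem: "d \<in> A" "e \<in> A" "a \<in> A" "b \<in> A" "c \<in> A" and "d \<notin> M" "e \<notin> M"
    and lin: "d * a + e * b - (d + e) * c \<in> M"
    and quad: "d * a\<^sup>2 + e * b\<^sup>2 - (d + e) * c\<^sup>2 \<in> M"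
  shows "a - b \<in> M"
proof -
  let ?X = "d * a + e * b - (d + e) * c" and ?Y = "d * a\<^sup>2 + e * b\<^sup>2 - (d + e) * c\<^sup>2"
  have "(d + e) * ?Y - (?X + 2 * ((d + e) * c)) * ?X \<in> M"
    using A_closed(8)[of 2]
    by (intro M_closed(3) M_closed(2) lin quad A_closed mem) simp_all
  moreover have "(d + e) * ?Y - (?X + 2 * ((d + e) * c)) * ?X = d * (e * ((a - b) * (a - b)))"
    by (simp add: power2_eq_square algebra_simps)
  ultimately have "d * (e * ((a - b) * (a - b))) \<in> M"
    by simp
  then have "e * ((a - b) * (a - b)) \<in> M"
    by (rule M_cancel[rotated -1]) (intro A_closed assms)+
  then have "(a - b) * (a - b) \<in> M"
    by (rule M_cancel[rotated -1]) (intro A_closed assms)+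
  then show ?thesis
    using prime_ideal A_closed(3) mem by blast
qed

text \<open>In both coordinates, the step from \<open>p\<close> to \<open>q\<close> and the step
  from \<open>q\<close> to \<open>r\<close> add up to the step from \<open>p\<close> to
  \<open>r\<close>. By \<open>parabola_convex_combination\<close> the parameters of \<open>e\<close>
  and \<open>f\<close> agree modulo \<open>M\<close>, and since these edges share \<open>q\<close>
  they are equal.\<close>

lemma C3_free_parabola_graph: "C3_free parabola_graph"
  unfolding C3_free_iff
proof (intro ballI allI impI notI)
  fix e f g p q r
  assume "e \<in> parabola_graph" "f \<in> parabola_graph" "g \<in> parabola_graph"
    and pqr: "distinct [p, q, r] \<and> {p, q} \<subseteq> e \<and> {q, r} \<subseteq> f \<and> {p, r} \<subseteq> g"
    and dist: "distinct [e, f, g]"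
  obtain x y a where e: "e = parabola_edge x y a" and mem_e: "x \<in> A" "y \<in> A" "a \<in> A"
    using parabola_graphE[OF \<open>e \<in> parabola_graph\<close>] .
  obtain x' y' b where f: "f = parabola_edge x' y' b" and mem_f: "x' \<in> A" "y' \<in> A" "b \<in> A"
    using parabola_graphE[OF \<open>f \<in> parabola_graph\<close>] .
  obtain x'' y'' c where g: "g = parabola_edge x'' y'' c" and mem_g: "x'' \<in> A" "y'' \<in> A" "c \<in> A"
    using parabola_graphE[OF \<open>g \<in> parabola_graph\<close>] .
  note mem = mem_e mem_f mem_g
  obtain i u u' where p: "i < 3" "u \<in> A" "u' \<in> A" "p = vertex i u u'"
    using parabola_edgeE pqr e mem by (metis insert_subset)
  obtain j v v' where q: "j < 3" "v \<in> A" "v' \<in> A" "q = vertex j v v'"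
    using parabola_edgeE pqr e mem by (metis insert_subset)
  obtain k w w' where r: "k < 3" "w \<in> A" "w' \<in> A" "r = vertex k w w'"
    using parabola_edgeE pqr f mem by (metis insert_subset)
  have sub: "{vertex i u u', vertex j v v'} \<subseteq> parabola_edge x y a"
    "{vertex j v v', vertex k w w'} \<subseteq> parabola_edge x' y' b"
    "{vertex i u u', vertex k w w'} \<subseteq> parabola_edge x'' y'' c"
    using pqr p q r e f g by auto
  have neq: "i \<noteq> j" "j \<noteq> k"
    using adjacent_vertices_parts_neq[OF sub(1)] adjacent_vertices_parts_neq[OF sub(2)]
      pqr p q r mem by auto
  let ?d = "part_diff i j" and ?e = "part_diff j k"
  have sum: "part_diff i k = ?d + ?e"
    by (simp add: part_diff_def)
  note E = parabola_edge_adjacent[OF sub(1) p(2,3) q(2,3) mem(1-3)]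
    and F = parabola_edge_adjacent[OF sub(2) q(2,3) r(2,3) mem(4-6)]
    and G = parabola_edge_adjacent[OF sub(3) p(2,3) r(2,3) mem(7-9)]
  have "a - b \<in> M"
  proof (rule parabola_convex_combination)
    show "?d * a + ?e * b - (?d + ?e) * c \<in> M"
      using M_closed(3)[OF M_closed(1)[OF E(1) F(1)] G(1)] unfolding sum
      by (simp add: algebra_simps)
    show "?d * a\<^sup>2 + ?e * b\<^sup>2 - (?d + ?e) * c\<^sup>2 \<in> M"
      using M_closed(3)[OF M_closed(1)[OF E(2) F(2)] G(2)] unfolding sum
      by (simp add: algebra_simps)
  qed (use part_diff_closed part_diff_notin neq p q r mem in auto)
  then have "e = f"
    using parabola_edge_eqI(1)[of q x y a x' y' b] pqr e f mem by auto
  with dist show False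
    by simp
qed

section \<open>Common neighbours in the construction\<close>

lemma M_scaled: "d \<in> A \<Longrightarrow> a \<in> M \<Longrightarrow> d * a - c \<in> M \<Longrightarrow> c \<in> M"
  using M_closed(3)[OF M_closed(2)] by fastforce

text \<open>Starting from one vertex, congruent parameters lead to congruent coordinates in a given
  part. Different neighbours in the same part therefore have incongruent parameters.\<close>

lemma M_cong_param:
  assumes "a \<in> A" "b \<in> A" "a - b \<in> M" "d \<in> A"
    and "d * a - (v - u) \<in> M" "d * a\<^sup>2 - (v' - u') \<in> M"
    and "d * b - (t - u) \<in> M" "d * b\<^sup>2 - (t' - u') \<in> M"
  shows "v - t \<in> M" "v' - t' \<in> M"
proof -
  have "d * (a - b) - (v - t) \<in> M" "d * (a\<^sup>2 - b\<^sup>2) - (v' - t') \<in> M"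
    using M_closed(3)[OF assms(5,7)] M_closed(3)[OF assms(6,8)] by (simp_all add: algebra_simps)
  then show "v - t \<in> M" "v' - t' \<in> M"
    using M_scaled assms(3,4) M_square_diff[OF assms(1-3)] by blast+
qed

text \<open>Divided differences: subtracting values at two roots and cancelling the difference of
  the roots leaves a linear expression, and a second such step isolates \<open>l\<close>.\<close>

lemma quadratic_three_roots:
  assumes mem: "l \<in> A" "m \<in> A" "a \<in> A" "b \<in> A" "c \<in> A"
    and roots: "l * a\<^sup>2 + m * a + n \<in> M" "l * b\<^sup>2 + m * b + n \<in> M" "l * c\<^sup>2 + m * c + n \<in> M"
    and distinct: "a - b \<notin> M" "a - c \<notin> M" "b - c \<notin> M"
  shows "l \<in> M"
proof -
  have closed: "l * (a + b) + m \<in> A" "l * (a + c) + m \<in> A"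
    by (intro A_closed(4,5) mem)+
  have "(a - b) * (l * (a + b) + m) \<in> M" "(a - c) * (l * (a + c) + m) \<in> M"
    using M_closed(3)[OF roots(1,2)] M_closed(3)[OF roots(1,3)]
    by (simp_all add: power2_eq_square algebra_simps)
  then have ab: "l * (a + b) + m \<in> M" and ac: "l * (a + c) + m \<in> M"
    using M_cancel[OF A_closed(3)[OF mem(3,4)] closed(1) distinct(1)]
      M_cancel[OF A_closed(3)[OF mem(3,5)] closed(2) distinct(2)] by simp_all
  have "(b - c) * l \<in> M"
    using M_closed(3)[OF ab ac] by (simp add: algebra_simps)
  then show "l \<in> M"
    by (rule M_cancel[OF A_closed(3)[OF mem(4,5)] mem(1) distinct(3)])
qed

text \<open>Let \<open>a\<close> and \<open>b\<close> be the parameters of the edges from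
  \<open>p\<close> and \<open>s\<close> to a common neighbour in part \<open>k\<close>. Then
  \<open>a - b\<close> and \<open>a\<^sup>2 - b\<^sup>2\<close> are determined by \<open>p\<close>
  and \<open>s\<close>; as \<open>a - b\<close> is nonzero, so is \<open>a + b\<close>, and hence
  \<open>a\<close> itself because \<open>2\<close> is cancellable.\<close>

lemma common_neighbours_same_part:
  assumes edges: "e1 \<in> parabola_graph" "f1 \<in> parabola_graph" "e2 \<in> parabola_graph" "f2 \<in> parabola_graph"
    and inc: "{p, r1} \<subseteq> e1" "{s, r1} \<subseteq> f1" "{p, r2} \<subseteq> e2" "{s, r2} \<subseteq> f2"
    and dist: "distinct [p, s, r1]" "distinct [p, s, r2]"
    and p: "p = vertex i u u'" "u \<in> A" "u' \<in> A" and s: "s = vertex i w w'" "w \<in> A" "w' \<in> A"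
    and r1: "r1 = vertex k v1 v1'" "v1 \<in> A" "v1' \<in> A" and r2: "r2 = vertex k v2 v2'" "v2 \<in> A" "v2' \<in> A"
    and "i < 3" "k < 3"
  shows "r1 = r2"
proof -
  let ?d = "part_diff i k"
  obtain a1 where a1: "a1 \<in> A" "i \<noteq> k" "?d * a1 - (v1 - u) \<in> M" "?d * a1\<^sup>2 - (v1' - u') \<in> M"
    using parabola_graph_adjacentE[OF edges(1) inc(1) _ p r1] dist by auto
  obtain b1 where b1: "b1 \<in> A" "i \<noteq> k" "?d * b1 - (v1 - w) \<in> M" "?d * b1\<^sup>2 - (v1' - w') \<in> M"
    using parabola_graph_adjacentE[OF edges(2) inc(2) _ s r1] dist by auto
  obtain a2 where a2: "a2 \<in> A" "i \<noteq> k" "?d * a2 - (v2 - u) \<in> M" "?d * a2\<^sup>2 - (v2' - u') \<in> M"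
    using parabola_graph_adjacentE[OF edges(3) inc(3) _ p r2] dist by auto
  obtain b2 where b2: "b2 \<in> A" "i \<noteq> k" "?d * b2 - (v2 - w) \<in> M" "?d * b2\<^sup>2 - (v2' - w') \<in> M"
    using parabola_graph_adjacentE[OF edges(4) inc(4) _ s r2] dist by auto
  have d: "?d \<in> A" "?d \<notin> M"
    using part_diff_closed part_diff_notin assms a1 by auto
  have "?d * (a1 - b1) - (w - u) \<in> M" and "?d * (a2 - b2) - (w - u) \<in> M"
    and "?d * (a1\<^sup>2 - b1\<^sup>2) - (w' - u') \<in> M" and "?d * (a2\<^sup>2 - b2\<^sup>2) - (w' - u') \<in> M"
    using M_closed(3)[OF a1(3) b1(3)] M_closed(3)[OF a2(3) b2(3)]
      M_closed(3)[OF a1(4) b1(4)] M_closed(3)[OF a2(4) b2(4)]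
    by (simp_all add: algebra_simps)
  note diff = this
  have "?d * ((a1 - b1) - (a2 - b2)) \<in> M" "?d * ((a1\<^sup>2 - b1\<^sup>2) - (a2\<^sup>2 - b2\<^sup>2)) \<in> M"
    using M_closed(3)[OF diff(1,2)] M_closed(3)[OF diff(3,4)] by (simp_all add: algebra_simps)
  then have lin: "(a1 - b1) - (a2 - b2) \<in> M" and quad: "(a1\<^sup>2 - b1\<^sup>2) - (a2\<^sup>2 - b2\<^sup>2) \<in> M"
    using M_cancel[OF d(1) _ d(2)] A_closed(3,7) a1 b1 a2 b2 by simp_all
  \<comment> \<open>Replacing \<open>a2 - b2\<close> by \<open>a1 - b1\<close> in the difference of
    squares lets the factor \<open>a1 - b1\<close> be taken out. If that factor is in
    \<open>M\<close>, then \<open>p\<close> and \<open>s\<close> coincide.\<close>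
  have "(a1\<^sup>2 - b1\<^sup>2) - (a2\<^sup>2 - b2\<^sup>2) - (a2 + b2) * ((a1 - b1) - (a2 - b2)) \<in> M"
    by (intro M_closed(3) M_closed(2) A_closed(4) lin quad a2 b2)
  then have "(a1 - b1) * ((a1 + b1) - (a2 + b2)) \<in> M"
    by (simp add: power2_eq_square algebra_simps)
  then consider "a1 - b1 \<in> M" | "(a1 + b1) - (a2 + b2) \<in> M"
    using prime_ideal A_closed(3,4) a1 b1 a2 b2 by meson
  then show ?thesis
  proof cases
    case 1
    have "w - u \<in> M" "w' - u' \<in> M"
      using M_scaled[OF d(1) 1 diff(1)] M_scaled[OF d(1) M_square_diff[OF a1(1) b1(1) 1] diff(3)] by auto
    then have "vertex i w w' = vertex i u u'"
      using p s by (simp add: vertex_eq_iff)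
    with dist p s show ?thesis
      by simp
  next
    case 2
    have "2 * (a1 - a2) \<in> M"
      using M_closed(1)[OF lin 2] by (simp add: algebra_simps)
    then have a: "a1 - a2 \<in> M"
      using M_cancel[of 2] two A_closed(8)[of 2] A_closed(3) a1 a2 by simp
    have "v1 - v2 \<in> M" "v1' - v2' \<in> M"
      using M_cong_param[OF a1(1) a2(1) a d(1) a1(3,4) a2(3,4)] by auto
    then show ?thesis
      using r1 r2 by (simp add: vertex_eq_iff)
  qed
qed

text \<open>The parameter \<open>a\<close> of the edge joining \<open>p\<close> to a common neighbour is a root of a quadratic
  polynomial that depends on \<open>p\<close> and \<open>s\<close> only.\<close>

lemma common_neighbours_different_parts:
  assumes edges: "e1 \<in> parabola_graph" "e2 \<in> parabola_graph" "e3 \<in> parabola_graph"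
      "f1 \<in> parabola_graph" "f2 \<in> parabola_graph" "f3 \<in> parabola_graph"
    and inc: "{p, r1} \<subseteq> e1" "{p, r2} \<subseteq> e2" "{p, r3} \<subseteq> e3" "{s, r1} \<subseteq> f1" "{s, r2} \<subseteq> f2" "{s, r3} \<subseteq> f3"
    and dist: "distinct [p, s, r1, r2, r3]"
    and p: "p = vertex i u u'" "u \<in> A" "u' \<in> A" and s: "s = vertex j w w'" "w \<in> A" "w' \<in> A"
    and r1: "r1 = vertex k v1 v1'" "v1 \<in> A" "v1' \<in> A" and r2: "r2 = vertex k v2 v2'" "v2 \<in> A" "v2' \<in> A"
    and r3: "r3 = vertex k v3 v3'" "v3 \<in> A" "v3' \<in> A"
    and "i < 3" "j < 3" "k < 3" "i \<noteq> j"
  shows False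
proof -
  let ?d = "part_diff i k" and ?e = "part_diff j k"
  obtain a1 where a1: "a1 \<in> A" "i \<noteq> k" "?d * a1 - (v1 - u) \<in> M" "?d * a1\<^sup>2 - (v1' - u') \<in> M"
    using parabola_graph_adjacentE[OF edges(1) inc(1) _ p r1] dist by auto
  obtain a2 where a2: "a2 \<in> A" "i \<noteq> k" "?d * a2 - (v2 - u) \<in> M" "?d * a2\<^sup>2 - (v2' - u') \<in> M"
    using parabola_graph_adjacentE[OF edges(2) inc(2) _ p r2] dist by auto
  obtain a3 where a3: "a3 \<in> A" "i \<noteq> k" "?d * a3 - (v3 - u) \<in> M" "?d * a3\<^sup>2 - (v3' - u') \<in> M"
    using parabola_graph_adjacentE[OF edges(3) inc(3) _ p r3] dist by auto
  obtain b1 where b1: "b1 \<in> A" "j \<noteq> k" "?e * b1 - (v1 - w) \<in> M" "?e * b1\<^sup>2 - (v1' - w') \<in> M"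
    using parabola_graph_adjacentE[OF edges(4) inc(4) _ s r1] dist by auto
  obtain b2 where b2: "b2 \<in> A" "j \<noteq> k" "?e * b2 - (v2 - w) \<in> M" "?e * b2\<^sup>2 - (v2' - w') \<in> M"
    using parabola_graph_adjacentE[OF edges(5) inc(5) _ s r2] dist by auto
  obtain b3 where b3: "b3 \<in> A" "j \<noteq> k" "?e * b3 - (v3 - w) \<in> M" "?e * b3\<^sup>2 - (v3' - w') \<in> M"
    using parabola_graph_adjacentE[OF edges(6) inc(6) _ s r3] dist by auto
  have d: "?d \<in> A" "?d \<notin> M" and e: "?e \<in> A" "?e \<notin> M"
    and ji: "part_diff j i \<in> A" "part_diff j i \<notin> M"
    using part_diff_closed part_diff_notin assms a1 b1 by auto
  let ?P = "w - u" and ?R = "w' - u'"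
  have root: "(?d * part_diff j i) * a\<^sup>2 + (2 * ?d * ?P) * a + (- ?P\<^sup>2 - ?e * ?R) \<in> M"
    if "a \<in> A" "b \<in> A" "?d * a - (v - u) \<in> M" "?d * a\<^sup>2 - (v' - u') \<in> M"
      "?e * b - (v - w) \<in> M" "?e * b\<^sup>2 - (v' - w') \<in> M" for a b v v'
  proof -
    let ?X = "?d * a - ?e * b - ?P" and ?Y = "?d * a\<^sup>2 - ?e * b\<^sup>2 - ?R"
    have X: "?X \<in> M" and Y: "?Y \<in> M"
      using M_closed(3)[OF that(3,5)] M_closed(3)[OF that(4,6)] by (simp_all add: algebra_simps)
    have "?X + 2 * (?e * b) \<in> A"
      using A_closed(8)[of 2] that(1,2) p s d e
      by (intro A_closed(3,4,5)) simp_all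
    \<comment> \<open>This combination eliminates \<open>b\<close>: the subtracted product is
      \<open>(?d * a - ?P)\<^sup>2 - (?e * b)\<^sup>2\<close>, and its last term cancels the one in
      \<open>?e * ?Y\<close>.\<close>
    then have "?e * ?Y - (?X + 2 * (?e * b)) * ?X \<in> M"
      by (intro M_closed(3)[OF M_closed(2)[OF e(1) Y] M_closed(2)[OF _ X]])
    moreover have diff: "part_diff j i = ?e - ?d"
      by (simp add: part_diff_def)
    ultimately show ?thesis
      unfolding diff by (simp add: power2_eq_square algebra_simps)
  qed
  have distinct_param: "a - a' \<notin> M"
    if "a \<in> A" "?d * a - (v - u) \<in> M" "?d * a\<^sup>2 - (v' - u') \<in> M"
      "a' \<in> A" "?d * a' - (t - u) \<in> M" "?d * a'\<^sup>2 - (t' - u') \<in> M"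
      "vertex k v v' \<noteq> vertex k t t'" "v \<in> A" "v' \<in> A" "t \<in> A" "t' \<in> A" for a a' v v' t t'
  proof
    assume a: "a - a' \<in> M"
    have "v - t \<in> M" "v' - t' \<in> M"
      using M_cong_param[OF that(1,4) a d(1) that(2,3,5,6)] by auto
    then show False
      using that by (simp add: vertex_eq_iff)
  qed
  \<comment> \<open>The parameters \<open>a1\<close>, \<open>a2\<close>, \<open>a3\<close> are
    pairwise incongruent roots, which forces the leading coefficient into \<open>M\<close>; yet it
    is a product of two elements outside the prime ideal \<open>M\<close>.\<close>
  have "?d * part_diff j i \<in> M"
  proof (rule quadratic_three_roots)
    show "a1 - a2 \<notin> M" "a1 - a3 \<notin> M" "a2 - a3 \<notin> M"
      using distinct_param[OF a1(1,3,4) a2(1,3,4)] distinct_param[OF a1(1,3,4) a3(1,3,4)]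
        distinct_param[OF a2(1,3,4) a3(1,3,4)] dist r1 r2 r3 by simp_all
    show "2 * ?d * ?P \<in> A"
      using A_closed(8)[of 2] d p s by (intro A_closed(3,5)) simp_all
  qed (rule root[OF a1(1) b1(1) a1(3,4) b1(3,4)] root[OF a2(1) b2(1) a2(3,4) b2(3,4)]
      root[OF a3(1) b3(1) a3(3,4) b3(3,4)] A_closed(5)[OF d(1) ji(1)] a1(1) a2(1) a3(1))+
  then show False
    using prime_ideal d ji by blast
qed

text \<open>Neighbours lie in other parts. If \<open>p\<close> and \<open>q\<close> share a part,
  two of their three common neighbours fall into the same one of the two remaining parts; if not,
  all three lie in the single remaining part. Each case has its own lemma above.\<close>

lemma K23_free_parabola_graph: "K23_free parabola_graph"
  unfolding K23_free_iff
proof (intro allI impI notI, elim conjE)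
  fix p q r1 r2 r3 e1 e2 e3 f1 f2 f3
  assume dist: "distinct [p, q, r1, r2, r3]" and "{e1, e2, e3, f1, f2, f3} \<subseteq> parabola_graph"
    and inc: "{p, r1} \<subseteq> e1" "{p, r2} \<subseteq> e2" "{p, r3} \<subseteq> e3" "{q, r1} \<subseteq> f1" "{q, r2} \<subseteq> f2" "{q, r3} \<subseteq> f3"
  then have edges: "e1 \<in> parabola_graph" "e2 \<in> parabola_graph" "e3 \<in> parabola_graph"
      "f1 \<in> parabola_graph" "f2 \<in> parabola_graph" "f3 \<in> parabola_graph"
    by auto
  obtain i u u' where p: "i < 3" "u \<in> A" "u' \<in> A" "p = vertex i u u'"
    using parabola_graph_vertexE[OF edges(1)] inc by blast
  obtain j w w' where q: "j < 3" "w \<in> A" "w' \<in> A" "q = vertex j w w'"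
    using parabola_graph_vertexE[OF edges(4)] inc by blast
  obtain k1 v1 v1' where r1: "k1 < 3" "v1 \<in> A" "v1' \<in> A" "r1 = vertex k1 v1 v1'"
    using parabola_graph_vertexE[OF edges(1)] inc by blast
  obtain k2 v2 v2' where r2: "k2 < 3" "v2 \<in> A" "v2' \<in> A" "r2 = vertex k2 v2 v2'"
    using parabola_graph_vertexE[OF edges(2)] inc by blast
  obtain k3 v3 v3' where r3: "k3 < 3" "v3 \<in> A" "v3' \<in> A" "r3 = vertex k3 v3 v3'"
    using parabola_graph_vertexE[OF edges(3)] inc by blast
  have i: "i \<noteq> k1" "i \<noteq> k2" "i \<noteq> k3"
    using parabola_graph_adjacentE[OF edges(1) inc(1) _ p(4,2,3) r1(4,2,3)]
      parabola_graph_adjacentE[OF edges(2) inc(2) _ p(4,2,3) r2(4,2,3)]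
      parabola_graph_adjacentE[OF edges(3) inc(3) _ p(4,2,3) r3(4,2,3)] dist by auto
  have j: "j \<noteq> k1" "j \<noteq> k2" "j \<noteq> k3"
    using parabola_graph_adjacentE[OF edges(4) inc(4) _ q(4,2,3) r1(4,2,3)]
      parabola_graph_adjacentE[OF edges(5) inc(5) _ q(4,2,3) r2(4,2,3)]
      parabola_graph_adjacentE[OF edges(6) inc(6) _ q(4,2,3) r3(4,2,3)] dist by auto
  show False
  proof (cases "i = j")
    case True
    note q' = q[folded True]
    have "k1 = k2 \<or> k1 = k3 \<or> k2 = k3"
      using i p(1) r1(1) r2(1) r3(1) by linarith
    moreover have "r1 = r2" if eq: "k1 = k2"
      by (rule common_neighbours_same_part[OF edges(1,4,2,5) inc(1,4,2,5) _ _ p(4,2,3) q'(4,2,3)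
            r1(4,2,3) r2(4,2,3)[folded eq] p(1) r1(1)]) (use dist in auto)
    moreover have "r1 = r3" if eq: "k1 = k3"
      by (rule common_neighbours_same_part[OF edges(1,4,3,6) inc(1,4,3,6) _ _ p(4,2,3) q'(4,2,3)
            r1(4,2,3) r3(4,2,3)[folded eq] p(1) r1(1)]) (use dist in auto)
    moreover have "r2 = r3" if eq: "k2 = k3"
      by (rule common_neighbours_same_part[OF edges(2,5,3,6) inc(2,5,3,6) _ _ p(4,2,3) q'(4,2,3)
            r2(4,2,3) r3(4,2,3)[folded eq] p(1) r2(1)]) (use dist in auto)
    ultimately show False
      using dist by auto
  next
    case False
    then have eq: "k1 = k2" "k1 = k3"
      using i j p(1) q(1) r1(1) r2(1) r3(1) by linarith+
    show False
      by (rule common_neighbours_different_parts[OF edges inc dist p(4,2,3) q(4,2,3) r1(4,2,3)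
            r2(4,2,3)[folded eq(1)] r3(4,2,3)[folded eq(2)] p(1) q(1) r1(1) False])
  qed
qed

section \<open>The three parts and the number of edges\<close>

definition part :: "nat \<Rightarrow> nat set" where
  "part i = (\<lambda>c. prod_encode (i, prod_encode c)) ` ({..<q} \<times> {..<q})"

lemma vertex_in_part_iff:
  assumes "u \<in> A" "u' \<in> A"
  shows "vertex i u u' \<in> part j \<longleftrightarrow> i = j"
proof -
  have "\<kappa> u < q" "\<kappa> u' < q"
    using assms code by blast+
  then show ?thesis
    by (auto simp: vertex_def part_def)
qed

lemma card_part: "card (part i) = q\<^sup>2"
proof -
  have "inj_on (\<lambda>c. prod_encode (i, prod_encode c)) ({..<q} \<times> {..<q})"
    by (auto simp: inj_on_def)
  then show ?thesis
    by (simp add: part_def card_image power2_eq_square)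
qed

lemma r_partite_parabola_graph:
  assumes "H \<subseteq> parabola_graph"
  shows "r_partite_hypergraph 3 (q\<^sup>2) part H"
  unfolding r_partite_hypergraph_def
proof (intro conjI allI impI ballI)
  show "finite (part i)" for i
    by (simp add: part_def)
  show "card (part i) = q\<^sup>2" for i
    by (rule card_part)
  show "part i \<inter> part j = {}" if "i \<noteq> j" for i j
    using that by (auto simp: part_def)
  fix e assume "e \<in> H"
  then obtain x y a where e: "e = parabola_edge x y a" and mem: "x \<in> A" "y \<in> A" "a \<in> A"
    using assms parabola_graphE by (metis subsetD)
  define v where "v i = vertex i (x + of_nat i * a) (y + of_nat i * a\<^sup>2)" for i
  have e_v: "e = v ` {..<3}"
    by (simp add: e parabola_edge_def v_def)
  have part: "v i \<in> part j \<longleftrightarrow> i = j" for i j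
    unfolding v_def by (intro vertex_in_part_iff A_closed mem)
  show "e \<subseteq> (\<Union>i<3. part i)"
    using part e_v by blast
  have "inj v"
    using part by (metis injI)
  then show "card e = 3"
    by (simp add: e_v card_image inj_on_def)
  show "card (e \<inter> part i) = 1" if "i < 3" for i
  proof -
    have "e \<inter> part i = {v i}"
      using part that e_v by auto
    then show ?thesis
      by simp
  qed
qed

text \<open>The vertices of an edge in parts 0 and 1 recover its base point and its parameter modulo
  \<open>M\<close>, so there are \<open>q ^ 3\<close> edges to choose from.\<close>

lemma exists_parabola_subgraph:
  obtains H where "H \<subseteq> parabola_graph" "card H = q\<^sup>2 * (q - 1)"
proof -
  \<comment> \<open>One representative per residue class is taken, because congruent triples define
    the same edge.\<close>
  obtain T where T: "T \<subseteq> A" "inj_on \<kappa> T" "\<kappa> ` T = {..<q}"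
    using subset_image_inj[of "{..<q}" \<kappa> A] code by auto
  have card_T: "card T = q"
    using card_image[OF T(2)] T(3) by simp
  have eqI: "t = t'" if "t \<in> T" "t' \<in> T" "t - t' \<in> M" for t t'
    using T that code_eq_iff[of t t'] by (auto simp: inj_on_def)
  define E where "E = (\<lambda>(x, y, a). parabola_edge x y a)"
  have "inj_on E (T \<times> T \<times> T)"
  proof (rule inj_onI, clarsimp simp: E_def)
    fix x y a x' y' b
    assume mem: "x \<in> T" "y \<in> T" "a \<in> T" "x' \<in> T" "y' \<in> T" "b \<in> T"
      and eq: "parabola_edge x y a = parabola_edge x' y' b"
    have A: "x \<in> A" "y \<in> A" "a \<in> A" "x' \<in> A" "y' \<in> A" "b \<in> A"
      using mem T(1) by auto
    have "vertex 0 x y \<in> parabola_edge x y a"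
      using A M_zero by (simp add: mem_parabola_edge_iff)
    then have "x - x' \<in> M" "y - y' \<in> M"
      using A unfolding eq by (auto simp: mem_parabola_edge_iff)
    then have xy: "x' = x" "y' = y"
      using eqI mem by auto
    have closed: "x + a \<in> A" "y + a\<^sup>2 \<in> A"
      by (intro A_closed A)+
    have "vertex 1 (x + a) (y + a\<^sup>2) \<in> parabola_edge x y a"
      using closed A M_zero by (simp add: mem_parabola_edge_iff)
    then have "a - b \<in> M"
      using closed A unfolding eq by (auto simp: mem_parabola_edge_iff xy)
    then show "x = x' \<and> y = y' \<and> a = b"
      using eqI mem xy by auto
  qed
  then have "card (E ` (T \<times> T \<times> T)) = q ^ 3"
    by (simp add: card_image card_cartesian_product card_T power3_eq_cube)
  moreover have "q\<^sup>2 * (q - 1) \<le> q ^ 3"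
    by (simp add: power2_eq_square power3_eq_cube)
  ultimately obtain H where H: "H \<subseteq> E ` (T \<times> T \<times> T)" "card H = q\<^sup>2 * (q - 1)"
    using obtain_subset_with_card_n by metis
  have "E ` (T \<times> T \<times> T) \<subseteq> parabola_graph"
  proof
    fix e assume "e \<in> E ` (T \<times> T \<times> T)"
    then obtain x y a where "e = parabola_edge x y a" "x \<in> T" "y \<in> T" "a \<in> T"
      unfolding E_def by auto
    then show "e \<in> parabola_graph"
      using T(1) unfolding parabola_graph_def by blast
  qed
  with H(1) have "H \<subseteq> parabola_graph"
    by (rule subset_trans)
  then show thesis
    using H(2) by (rule that)
qed

end

lemma exists_extremal_3_partite:
  assumes "odd_prime_power q"
  shows "\<exists>(P::nat \<Rightarrow> nat set) (H::nat set set).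
    r_partite_hypergraph 3 (q\<^sup>2) P H \<and> C2_C3_K23_free H \<and> card H = q\<^sup>2 * (q - 1)"
proof -
  obtain A M :: "complex set" and \<kappa> where "finite_quotient_domain A M \<kappa> q"
    using exists_finite_quotient_domain[OF assms] .
  then interpret finite_quotient_domain A M \<kappa> q .
  obtain H where H: "H \<subseteq> parabola_graph" "card H = q\<^sup>2 * (q - 1)"
    using exists_parabola_subgraph .
  have "C2_C3_K23_free parabola_graph"
    by (simp add: C2_C3_K23_free_def C2_free_parabola_graph C3_free_parabola_graph
        K23_free_parabola_graph)
  then show ?thesis
    using r_partite_parabola_graph[OF H(1)] C2_C3_K23_free_subset[OF _ H(1)] H(2) by blast
qed

theorem theorem1p3:
  shows "(\<forall>(r::nat) (n::nat) (P::nat \<Rightarrow> 'a set) (H::'a set set).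
            r \<ge> 3 \<and> r_partite_hypergraph r n P H \<and> C2_C3_K23_free H \<longrightarrow>
            real (card H) \<le> sqrt (2 / (real r - 1)) * real n powr (3/2) + real n)
       \<and> (\<forall>q::nat. odd_prime_power q \<longrightarrow>
            (\<exists>(P::nat \<Rightarrow> nat set) (H::nat set set).
               r_partite_hypergraph 3 (q^2) P H \<and> C2_C3_K23_free H \<and>
               card H = q^2 * (q - 1)))"
  using free_partite_hypergraph.card_edges_upper_bound[OF free_partite_hypergraph.intro]
    exists_extremal_3_partite by blast

end
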